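(* Let $\{F_n\}_{n\in\mathbb Z^+}$ be a sequence of complex-valued measurable functions on $\mathbb T^\infty$, and suppose that the sequence converges almost everywhere to a function $F$. Suppose also that there exists a function $G\in L^1(\mathbb T^\infty)$ such that, for every $n\in\mathbb Z^+$, $|F_n(\chi)|\le|G(\chi)|$ for almost every $\chi\in\mathbb T^\infty$. Then $F$ and $F_n$ are in $L^1(\mathbb T^\infty)$ for all $n\in\mathbb Z^+$, and $$\lim_{n\to\infty}\lim_{T\to\infty}\frac1{2T}\int_{-T}^TF_n(\chi\,\mathfrak p^{-it})\,\mathrm dt=\lim_{T\to\infty}\frac1{2T}\int_{-T}^TF(\chi\,\mathfrak p^{-it})\,\mathrm dt$$ for almost every $\chi\in\mathbb T^\infty$.
   Context: $\mathbb T$ is the unit circle in $\mathbb C$, $\mathbb T^\infty=\mathbb T\times\mathbb T\times\cdots$ is the countably infinite-dimensional torus (a compact abelian group under coordinatewise multiplication), and "measurable", "almost every" and $L^1(\mathbb T^\infty)$ refer to its normalized Haar measure $m_\infty$ (the product of the normalized arclength measures). The Kronecker flow is $\mathfrak p^{-it}=(2^{-it},3^{-it},5^{-it},\dots)\in\mathbb T^\infty$ for $t\in\mathbb R$ (the coordinates run over the primes); $\chi\,\mathfrak p^{-it}$ is the product in the group $\mathbb T^\infty$. *)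

theory Defs
  imports "HOL-Probability.Probability" "HOL-Computational_Algebra.Primes"
begin

text \<open>Normalized arclength measure on the Borel sets of the unit circle, as the image of the
  uniform distribution of the angle.\<close>

definition circle_measure :: "complex measure" where
  "circle_measure =
     distr (uniform_measure lborel {0..<2 * pi}) (restrict_space borel (sphere 0 1)) cis"

text \<open>The points of the infinite torus are the sequences with all values in the unit circle.
  The measure is completed: measurable means Haar measurable rather than Borel, so that an
  almost everywhere limit of measurable functions is again measurable.\<close>

definition torus_haar :: "(nat \<Rightarrow> complex) measure" where
  "torus_haar = completion (\<Pi>\<^sub>M n\<in>UNIV. circle_measure)"

definition torus_mult :: "(nat \<Rightarrow> complex) \<Rightarrow> (nat \<Rightarrow> complex) \<Rightarrow> (nat \<Rightarrow> complex)" where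
  "torus_mult z w = (\<lambda>n. z n * w n)"

text \<open>\<^term>\<open>enumerate {p::nat. prime p} n\<close> is the \<open>n\<close>-th prime in increasing order, starting
  with \<open>2\<close> at \<open>n = 0\<close>.\<close>

definition kronecker_flow :: "real \<Rightarrow> (nat \<Rightarrow> complex)" where
  "kronecker_flow t =
     (\<lambda>n. of_nat (enumerate {p::nat. prime p} n) powr (- (\<i> * complex_of_real t)))"

text \<open>The integral over \<open>[-T, T]\<close> is a Lebesgue integral: along an orbit, a Haar measurable
  function need not be Borel measurable in \<open>t\<close>.\<close>

definition flow_average :: "((nat \<Rightarrow> complex) \<Rightarrow> complex) \<Rightarrow> (nat \<Rightarrow> complex) \<Rightarrow> real \<Rightarrow> complex" where
  "flow_average F z T =
     (1 / (2 * T)) *\<^sub>R (LINT t:{-T..T}|lebesgue. F (torus_mult z (kronecker_flow t)))"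

text \<open>The Bochner integral is \<open>0\<close> by convention for a non-integrable integrand, so local
  integrability along the orbit has to be asserted separately.\<close>

definition flow_integrable :: "((nat \<Rightarrow> complex) \<Rightarrow> complex) \<Rightarrow> (nat \<Rightarrow> complex) \<Rightarrow> bool" where
  "flow_integrable F z \<longleftrightarrow>
     (\<forall>T>0. set_integrable lebesgue {-T..T} (\<lambda>t. F (torus_mult z (kronecker_flow t))))"

end

theory Submission
  imports Defs
begin

text \<open>The Kronecker flow \<^term>\<open>\<lambda>t z. torus_mult z (kronecker_flow t)\<close> is a
measurable flow on the torus that preserves Haar measure, because each coordinate is only rotated. The argument concerns measure preserving flows on probability spaces in
general: the limits of the means are compared with each other rather than computed.

Existence of the inner limits is Birkhoff's pointwise ergodic theorem (\<open>birkhoff\<close> in discrete time,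
\<open>orbit_mean_converges\<close> for flows). It is derived from Garsia's maximal inequality, applied on the
invariant sets where the means oscillate between two given levels. Continuous time reduces to discrete time by
integrating the function over unit time intervals.

For the interchange of limits (\<open>dominated_convergence_orbit_mean\<close>) let \<open>g\<^sub>k\<close> be the supremum of
\<open>|F\<^sub>n - F|\<close> over \<open>n \<ge> k\<close>. It is dominated by \<open>2 |G|\<close> and tends to \<open>0\<close>, so its integral tends to \<open>0\<close>. The
limit \<open>h\<^sub>k\<close> of its means along orbits bounds the distance between the limits for \<open>F\<^sub>n\<close> and for \<open>F\<close>
whenever \<open>n \<ge> k\<close>. By Fatou's lemma \<open>\<integral> h\<^sub>k \<le> \<integral> g\<^sub>k\<close>, hence the lower limit of \<open>h\<^sub>k\<close> vanishes almost everywhere.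

The functions of the theorem are measurable only for the completed measure, whereas the flow is jointly
measurable in time and space for Borel sets. They are therefore replaced by Borel functions off a
Borel null set; by Tonelli, almost every orbit meets that set only for a null set of times (\<open>AE_orbit\<close>),
so neither integrability along the orbit nor the means change.\<close>

section \<open>Birkhoff's ergodic theorem in discrete time\<close>

locale measure_preserving_map = prob_space M for M :: "'a measure" +
  fixes T :: "'a \<Rightarrow> 'a"
  assumes T_measurable [measurable]: "T \<in> M \<rightarrow>\<^sub>M M"
    and distr_T: "distr M M T = M"
begin

lemma T_space: "x \<in> space M \<Longrightarrow> T x \<in> space M"
  using measurable_space[OF T_measurable] .

lemma integrable_comp_T:
  fixes f :: "'a \<Rightarrow> real"
  assumes "integrable M f"
  shows "integrable M (\<lambda>x. f (T x))"
  using assms integrable_distr[OF T_measurable, of f] distr_T by simp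

lemma integral_comp_T:
  fixes f :: "'a \<Rightarrow> real"
  assumes "f \<in> borel_measurable M"
  shows "(LINT x|M. f (T x)) = (LINT x|M. f x)"
  using integral_distr[OF T_measurable, of f] assms distr_T by simp

primrec birkhoff_sum :: "('a \<Rightarrow> real) \<Rightarrow> nat \<Rightarrow> 'a \<Rightarrow> real" where
  "birkhoff_sum f 0 x = 0"
| "birkhoff_sum f (Suc n) x = f x + birkhoff_sum f n (T x)"

text \<open>The maximum of \<^term>\<open>birkhoff_sum f k x\<close> over \<open>k \<le> n\<close>; the recursive form is what the
  proof of the maximal inequality exploits.\<close>

primrec max_birkhoff_sum :: "('a \<Rightarrow> real) \<Rightarrow> nat \<Rightarrow> 'a \<Rightarrow> real" where
  "max_birkhoff_sum f 0 x = 0"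
| "max_birkhoff_sum f (Suc n) x = max 0 (f x + max_birkhoff_sum f n (T x))"

lemma borel_measurable_birkhoff_sum [measurable]:
  assumes [measurable]: "f \<in> borel_measurable M"
  shows "birkhoff_sum f n \<in> borel_measurable M"
proof (induction n)
  case (Suc n)
  note Suc [measurable]
  show ?case by simp
qed simp

lemma integrable_max_birkhoff_sum:
  assumes "integrable M f"
  shows "integrable M (max_birkhoff_sum f n)"
proof (induction n)
  case (Suc n)
  then show ?case
    using assms by (auto intro!: integrable_max Bochner_Integration.integrable_add integrable_comp_T)
qed simp

lemma max_birkhoff_sum_nonneg: "0 \<le> max_birkhoff_sum f n x"
  by (cases n) auto

lemma max_birkhoff_sum_mono: "max_birkhoff_sum f n x \<le> max_birkhoff_sum f (Suc n) x"
proof (induction n arbitrary: x)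
  case (Suc n)
  have "max 0 (f x + max_birkhoff_sum f n (T x)) \<le> max 0 (f x + max_birkhoff_sum f (Suc n) (T x))"
    using Suc[of "T x"] by (intro max.mono) (simp_all del: max_birkhoff_sum.simps)
  then show ?case by (simp only: max_birkhoff_sum.simps)
qed simp

lemma birkhoff_sum_le_max: "birkhoff_sum f n x \<le> max_birkhoff_sum f n x"
proof (induction n arbitrary: x)
  case (Suc n)
  have "f x + birkhoff_sum f n (T x) \<le> f x + max_birkhoff_sum f n (T x)"
    using Suc[of "T x"] by simp
  then show ?case by simp
qed simp

lemma max_birkhoff_sum_attained: "\<exists>k\<le>n. max_birkhoff_sum f n x = birkhoff_sum f k x"
proof (induction n arbitrary: x)
  case (Suc n)
  obtain k where "k \<le> n" "max_birkhoff_sum f n (T x) = birkhoff_sum f k (T x)"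
    using Suc by blast
  then show ?case
    by (cases "f x + max_birkhoff_sum f n (T x) \<ge> 0")
       (auto intro: exI[of _ "Suc k"] exI[of _ 0])
qed simp

text \<open>Garsia's argument. Write \<open>m\<^sub>n\<close> for the maximal sum. Where \<open>m\<^sub>n\<^sub>+\<^sub>1 > 0\<close> the recursion
gives \<open>f = m\<^sub>n\<^sub>+\<^sub>1 - m\<^sub>n \<circ> T\<close> exactly, and elsewhere \<open>m\<^sub>n\<^sub>+\<^sub>1 - m\<^sub>n \<circ> T \<le> 0\<close>. So the integral is
at least \<open>\<integral> m\<^sub>n\<^sub>+\<^sub>1 - \<integral> m\<^sub>n \<circ> T = \<integral> m\<^sub>n\<^sub>+\<^sub>1 - \<integral> m\<^sub>n\<close>, because \<open>T\<close> preserves the measure, and this is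
nonnegative because the maximal sums increase with \<open>n\<close>.\<close>

lemma integral_max_birkhoff_sum_pos_nonneg:
  assumes f: "integrable M f"
  shows "0 \<le> (LINT x|M. indicator {x. max_birkhoff_sum f (Suc n) x > 0} x * f x)"
proof -
  define m where "m = max_birkhoff_sum f n"
  define m' where "m' = max_birkhoff_sum f (Suc n)"
  have [measurable]: "m \<in> borel_measurable M" "m' \<in> borel_measurable M" "f \<in> borel_measurable M"
    and int: "integrable M m" "integrable M m'" "integrable M (\<lambda>x. m (T x))"
    using integrable_max_birkhoff_sum[OF f] f
    by (auto simp: m_def m'_def intro!: integrable_comp_T)
  have "0 \<le> (LINT x|M. m' x) - (LINT x|M. m x)"
    using integral_mono[OF int(1,2)] max_birkhoff_sum_mono[of f n]
    by (simp add: m_def m'_def del: max_birkhoff_sum.simps)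
  also have "\<dots> = (LINT x|M. m' x - m (T x))"
    using int by (simp add: integral_comp_T)
  also have "\<dots> \<le> (LINT x|M. indicator {x. m' x > 0} x * f x)"
  proof (rule integral_mono)
    have "integrable M (\<lambda>x. indicator {x\<in>space M. m' x > 0} x *\<^sub>R f x)"
      by (intro integrable_mult_indicator f) measurable
    then show "integrable M (\<lambda>x. indicator {x. m' x > 0} x * f x)"
      by (rule Bochner_Integration.integrable_cong[THEN iffD1, OF refl, rotated])
         (auto simp: indicator_def)
    show "m' x - m (T x) \<le> indicator {x. m' x > 0} x * f x" for x
      using max_birkhoff_sum_nonneg[of f n "T x"]
      by (auto simp: m_def m'_def max_def indicator_def)
  qed (use int in auto)
  finally show ?thesis by (simp add: m'_def)
qed

text \<open>The sets on which the finite maxima are positive increase to the set on which some Birkhoff sum is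
positive, so the inequality passes to the limit by dominated convergence.\<close>

lemma maximal_ergodic_inequality:
  assumes f: "integrable M f"
  shows "0 \<le> (LINT x|M. indicator {x. \<exists>n. birkhoff_sum f n x > 0} x * f x)"
proof -
  have [measurable]: "f \<in> borel_measurable M" using f by auto
  have [measurable]: "max_birkhoff_sum f n \<in> borel_measurable M" for n
    using integrable_max_birkhoff_sum[OF f] by auto
  let ?E = "{x. \<exists>n. birkhoff_sum f n x > 0}"
  let ?u = "\<lambda>n x. indicator {x. max_birkhoff_sum f (Suc n) x > 0} x * f x"
  have "(\<lambda>n. LINT x|M. ?u n x) \<longlonglongrightarrow> (LINT x|M. indicator ?E x * f x)"
  proof (rule integral_dominated_convergence)
    have "{x\<in>space M. \<exists>n. birkhoff_sum f n x > 0} \<in> sets M" by measurable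
    then have "(\<lambda>x. indicator {x\<in>space M. \<exists>n. birkhoff_sum f n x > 0} x * f x) \<in> borel_measurable M"
      by measurable
    then show "(\<lambda>x. indicator ?E x * f x) \<in> borel_measurable M"
      by (rule measurable_cong[THEN iffD1, rotated]) (auto simp: indicator_def)
    show "?u n \<in> borel_measurable M" for n
    proof -
      have "(\<lambda>x. indicator {x\<in>space M. max_birkhoff_sum f (Suc n) x > 0} x * f x) \<in> borel_measurable M"
        by (intro borel_measurable_times borel_measurable_indicator) measurable
      then show ?thesis
        by (rule measurable_cong[THEN iffD1, rotated]) (auto simp: indicator_def)
    qed
    show "integrable M (\<lambda>x. norm (f x))" using f by auto
    show "AE x in M. norm (?u n x) \<le> norm (f x)" for n by (auto simp: indicator_def)
    show "AE x in M. (\<lambda>n. ?u n x) \<longlonglongrightarrow> indicator ?E x * f x"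
    proof (rule AE_I2)
      fix x
      show "(\<lambda>n. ?u n x) \<longlonglongrightarrow> indicator ?E x * f x"
      proof (cases "x \<in> ?E")
        case True
        then obtain n where n: "birkhoff_sum f n x > 0" by auto
        have mono: "incseq (\<lambda>n. max_birkhoff_sum f n x)"
          using max_birkhoff_sum_mono by (intro incseq_SucI)
        have "?u k x = indicator ?E x * f x" if "k \<ge> n" for k
        proof -
          have "max_birkhoff_sum f n x \<le> max_birkhoff_sum f (Suc k) x"
            using incseqD[OF mono, of n "Suc k"] that by (simp del: max_birkhoff_sum.simps)
          then have "max_birkhoff_sum f (Suc k) x > 0"
            using n birkhoff_sum_le_max[of f n x] by linarith
          then show ?thesis using True by (simp del: max_birkhoff_sum.simps)
        qed
        then show ?thesis
          by (intro tendsto_eventually) (auto simp: eventually_sequentially)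
      next
        case False
        have "\<not> max_birkhoff_sum f k x > 0" for k
          using max_birkhoff_sum_attained[of k f x] False by auto
        then have "?u k x = 0" for k
          by (simp_all del: max_birkhoff_sum.simps)
        moreover have "indicator ?E x * f x = 0" using False by simp
        ultimately show ?thesis by (simp only: tendsto_const)
      qed
    qed
  qed
  then show ?thesis
    by (rule LIMSEQ_le_const) (use integral_max_birkhoff_sum_pos_nonneg[OF f] in auto)
qed

text \<open>The maximal inequality localized to an invariant set \<open>D\<close>: it is applied to \<open>(f - b) \<cdot> 1\<^sub>D\<close>, whose
Birkhoff sums vanish off \<open>D\<close> and on \<open>D\<close> are those of \<open>f - b\<close>, since orbits stay inside or outside
\<open>D\<close>. Hence the set where one of them is positive is \<open>D\<close> itself.\<close>

lemma measure_le_integral_invariant_set: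
  assumes f: "integrable M f" and D [measurable]: "D \<in> sets M"
    and inv: "\<And>x. x \<in> space M \<Longrightarrow> T x \<in> D \<longleftrightarrow> x \<in> D"
    and gt: "\<And>x. x \<in> D \<Longrightarrow> \<exists>n. birkhoff_sum f n x > b * real n"
  shows "b * prob D \<le> (LINT x|M. indicator D x * f x)"
proof -
  define g where "g = (\<lambda>x. indicator D x * (f x - b))"
  have int: "integrable M (\<lambda>x. indicator D x * f x)" "integrable M (\<lambda>x. indicator D x * b)"
    using integrable_mult_indicator[OF D f] integrable_mult_indicator[OF D, of "\<lambda>_. b"] by auto
  have g: "integrable M g"
    using Bochner_Integration.integrable_diff[OF int] by (simp add: g_def algebra_simps)
  have S: "birkhoff_sum g n x = indicator D x * (birkhoff_sum f n x - b * real n)"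
    if "x \<in> space M" for n x
    using that
  proof (induction n arbitrary: x)
    case (Suc n)
    have "birkhoff_sum g (Suc n) x
        = g x + indicator D (T x) * (birkhoff_sum f n (T x) - b * real n)"
      using Suc.IH[of "T x"] Suc.prems T_space by simp
    then show ?case
      using inv[OF Suc.prems] by (cases "x \<in> D") (auto simp: g_def algebra_simps)
  qed simp
  have pos: "(\<exists>n. birkhoff_sum g n x > 0) \<longleftrightarrow> x \<in> D" if x: "x \<in> space M" for x
    using gt[of x] by (auto simp: S[OF x] indicator_def)
  have "0 \<le> (LINT x|M. indicator {x. \<exists>n. birkhoff_sum g n x > 0} x * g x)"
    by (rule maximal_ergodic_inequality[OF g])
  also have "\<dots> = (LINT x|M. indicator D x * f x - indicator D x * b)"
  proof (rule Bochner_Integration.integral_cong[OF refl])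
    fix x assume x: "x \<in> space M"
    show "indicator {x. \<exists>n. birkhoff_sum g n x > 0} x * g x = indicator D x * f x - indicator D x * b"
      using pos[OF x] by (cases "x \<in> D") (simp_all add: g_def)
  qed
  also have "\<dots> = (LINT x|M. indicator D x * f x) - b * prob D"
    using int by simp
  finally show ?thesis by simp
qed

definition upper_mean :: "('a \<Rightarrow> real) \<Rightarrow> 'a \<Rightarrow> ereal" where
  "upper_mean f x = limsup (\<lambda>n. ereal (birkhoff_sum f n x / real n))"

lemma borel_measurable_upper_mean [measurable]:
  assumes [measurable]: "f \<in> borel_measurable M"
  shows "upper_mean f \<in> borel_measurable M"
  unfolding upper_mean_def by measurable

text \<open>\<open>S\<^sub>n(T x)/n\<close> and \<open>S\<^sub>n\<^sub>+\<^sub>1(x)/(n+1)\<close> differ by a factor tending to \<open>1\<close> and a term tending to \<open>0\<close>.\<close>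

lemma upper_mean_T: "upper_mean f (T x) = upper_mean f x"
proof -
  let ?v = "\<lambda>n. ereal (birkhoff_sum f n x / real n)"
  let ?c = "\<lambda>n. ereal (real (Suc n) / real n)"
  let ?d = "\<lambda>n. ereal (- f x / real n)"
  have c: "?c \<longlonglongrightarrow> ereal 1"
    using LIMSEQ_Suc_n_over_n by (intro tendsto_ereal) simp
  have d: "?d \<longlonglongrightarrow> ereal 0"
    by (intro tendsto_ereal lim_const_over_n)
  have "upper_mean f (T x) = limsup (\<lambda>n. ?d n + ?c n * ?v (Suc n))"
    unfolding upper_mean_def
  proof (rule Limsup_eq)
    show "\<forall>\<^sub>F n in sequentially. ereal (birkhoff_sum f n (T x) / real n) = ?d n + ?c n * ?v (Suc n)"
      using eventually_gt_at_top[of 0]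
    proof eventually_elim
      case (elim n)
      have "birkhoff_sum f n (T x) / real n = - f x / real n + birkhoff_sum f (Suc n) x / real n"
        by (simp add: add_divide_distrib)
      also have "birkhoff_sum f (Suc n) x / real n
          = (real (Suc n) / real n) * (birkhoff_sum f (Suc n) x / real (Suc n))"
        by (simp del: birkhoff_sum.simps of_nat_Suc)
      finally show ?case by (simp del: birkhoff_sum.simps of_nat_Suc)
    qed
  qed
  also have "\<dots> = 0 + limsup (\<lambda>n. ?c n * ?v (Suc n))"
    using ereal_limsup_lim_add[OF d, of "\<lambda>n. ?c n * ?v (Suc n)"] by (simp only: zero_ereal_def abs_ereal.simps) simp
  also have "limsup (\<lambda>n. ?c n * ?v (Suc n)) = limsup (\<lambda>n. ?v (Suc n))"
    using ereal_limsup_lim_mult[OF c, of "\<lambda>n. ?v (Suc n)"]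
    by (simp del: birkhoff_sum.simps of_nat_Suc times_ereal.simps flip: one_ereal_def)
  also have "\<dots> = limsup ?v"
    using limsup_shift[of ?v] by (simp del: birkhoff_sum.simps of_nat_Suc)
  finally show ?thesis by (simp add: upper_mean_def)
qed

lemma upper_mean_gtE:
  assumes "ereal b < upper_mean f x"
  obtains n where "birkhoff_sum f n x > b * real n"
proof -
  have "\<not> (\<forall>n>0. birkhoff_sum f n x \<le> b * real n)"
  proof
    assume "\<forall>n>0. birkhoff_sum f n x \<le> b * real n"
    then have "\<forall>\<^sub>F n in sequentially. ereal (birkhoff_sum f n x / real n) \<le> ereal b"
      by (intro eventually_mono[OF eventually_gt_at_top[of 0]]) (simp add: divide_le_eq)
    then have "upper_mean f x \<le> ereal b"
      unfolding upper_mean_def by (rule Limsup_bounded)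
    then show False using assms by simp
  qed
  then show ?thesis using that by (auto simp: not_le)
qed

text \<open>On the invariant set \<open>D\<close> where the upper mean is infinite, \<open>b \<cdot> prob D \<le> \<integral>\<^sub>D f\<close> for every real \<open>b\<close>, which
forces \<open>prob D = 0\<close>.\<close>

lemma AE_upper_mean_finite:
  assumes f: "integrable M f"
  shows "AE x in M. upper_mean f x < \<infinity>"
proof -
  have [measurable]: "f \<in> borel_measurable M" using f by auto
  define D where "D = {x\<in>space M. upper_mean f x = \<infinity>}"
  have D [measurable]: "D \<in> sets M" unfolding D_def by measurable
  have le: "b * prob D \<le> (LINT x|M. indicator D x * f x)" for b
  proof (rule measure_le_integral_invariant_set[OF f D])
    show "T x \<in> D \<longleftrightarrow> x \<in> D" if "x \<in> space M" for x
      using that T_space by (auto simp: D_def upper_mean_T)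
    show "\<exists>n. birkhoff_sum f n x > b * real n" if "x \<in> D" for x
      using that upper_mean_gtE[of b f x] by (auto simp: D_def)
  qed
  have "prob D = 0"
  proof (rule ccontr)
    assume "prob D \<noteq> 0"
    then show False
      using le[of "((LINT x|M. indicator D x * f x) + 1) / prob D"] by simp
  qed
  then have "AE x in M. x \<notin> D"
    by (intro AE_not_in) (auto simp: null_sets_def emeasure_eq_measure)
  then show ?thesis
    using AE_space by eventually_elim (auto simp: D_def less_top)
qed

text \<open>On the invariant set \<open>D\<close> in question the localized maximal inequality holds both for \<open>f\<close> with bound
\<open>b\<close> and for \<open>- f\<close> with bound \<open>- a\<close>, so \<open>b \<cdot> prob D \<le> \<integral>\<^sub>D f \<le> a \<cdot> prob D\<close> with \<open>a < b\<close>.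
The condition on \<open>- f\<close> says that
the lower limit of the means of \<open>f\<close> is less than \<open>a\<close>.\<close>

lemma AE_not_oscillating:
  assumes f: "integrable M f" and "a < b"
  shows "AE x in M. \<not> (ereal b < upper_mean f x \<and> ereal (- a) < upper_mean (\<lambda>x. - f x) x)"
proof -
  have [measurable]: "f \<in> borel_measurable M" using f by auto
  define D where "D = {x\<in>space M. ereal b < upper_mean f x \<and> ereal (- a) < upper_mean (\<lambda>x. - f x) x}"
  have D [measurable]: "D \<in> sets M" unfolding D_def by measurable
  have inv: "T x \<in> D \<longleftrightarrow> x \<in> D" if "x \<in> space M" for x
    using that T_space by (auto simp: D_def upper_mean_T)
  have "b * prob D \<le> (LINT x|M. indicator D x * f x)"
    by (rule measure_le_integral_invariant_set[OF f D inv])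
       (auto simp: D_def elim: upper_mean_gtE)
  moreover have "- a * prob D \<le> (LINT x|M. indicator D x * - f x)"
  proof (rule measure_le_integral_invariant_set[OF _ D inv])
    show "\<exists>n. birkhoff_sum (\<lambda>x. - f x) n x > - a * real n" if "x \<in> D" for x
    proof -
      have "ereal (- a) < upper_mean (\<lambda>x. - f x) x" using that by (simp add: D_def)
      then show ?thesis by (rule upper_mean_gtE) blast
    qed
  qed (use f in auto)
  ultimately have "(b - a) * prob D \<le> 0"
    by (simp add: algebra_simps)
  then have "prob D \<le> 0"
    using \<open>a < b\<close> by (simp add: mult_le_0_iff)
  then have "prob D = 0" by (simp add: measure_le_0_iff)
  then have "AE x in M. x \<notin> D"
    by (intro AE_not_in) (auto simp: null_sets_def emeasure_eq_measure)
  then show ?thesis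
    using AE_space by eventually_elim (auto simp: D_def)
qed

text \<open>Outside countably many null sets the lower limit of the means cannot lie strictly below the upper
limit, since two rational numbers would fit in between, and neither limit is infinite.\<close>

theorem birkhoff:
  assumes f: "integrable M f"
  shows "AE x in M. convergent (\<lambda>n. birkhoff_sum f n x / real n)"
proof -
  have "AE x in M. \<forall>a\<in>\<rat>. \<forall>b\<in>\<rat>. a < b \<longrightarrow>
    \<not> (ereal b < upper_mean f x \<and> ereal (- a) < upper_mean (\<lambda>x. - f x) x)"
    using AE_not_oscillating[OF f] by (auto simp: AE_ball_countable countable_rat)
  moreover have "AE x in M. upper_mean f x < \<infinity>"
    by (rule AE_upper_mean_finite[OF f])
  moreover have "AE x in M. upper_mean (\<lambda>x. - f x) x < \<infinity>"
    using f by (intro AE_upper_mean_finite) auto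
  ultimately show ?thesis
  proof eventually_elim
    case (elim x)
    let ?v = "\<lambda>n. birkhoff_sum f n x / real n"
    have neg: "birkhoff_sum (\<lambda>x. - f x) n y = - birkhoff_sum f n y" for n y
      by (induction n arbitrary: y) auto
    have lower: "liminf (\<lambda>n. ereal (?v n)) = - upper_mean (\<lambda>x. - f x) x"
      using ereal_Limsup_uminus[of sequentially "\<lambda>n. ereal (?v n)"]
      by (simp add: upper_mean_def neg)
    have "upper_mean f x \<le> liminf (\<lambda>n. ereal (?v n))"
    proof (rule ccontr)
      assume "\<not> ?thesis"
      then have "- upper_mean (\<lambda>x. - f x) x < upper_mean f x" by (simp add: lower)
      then obtain c where c: "- upper_mean (\<lambda>x. - f x) x < ereal c" "ereal c < upper_mean f x"
        using ereal_dense2 by blast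
      obtain d where d: "ereal c < ereal d" "ereal d < upper_mean f x"
        using ereal_dense2[OF c(2)] by blast
      obtain a where a: "a \<in> \<rat>" "c < a" "a < d"
        using d Rats_dense_in_real[of c d] by auto
      obtain b where b: "b \<in> \<rat>" "a < b" "b < d"
        using a Rats_dense_in_real[of a d] by auto
      have "ereal (- a) < upper_mean (\<lambda>x. - f x) x"
      proof -
        have "- upper_mean (\<lambda>x. - f x) x < ereal a"
          using c(1) a(2) by (meson ereal_less_eq(3) less_imp_le less_le_trans)
        then show ?thesis by (simp add: ereal_uminus_less_reorder)
      qed
      moreover have "ereal b < upper_mean f x"
        using b(3) d(2) less_trans[of "ereal b" "ereal d"] by simp
      ultimately show False using elim(1) a b by blast
    qed
    moreover have "liminf (\<lambda>n. ereal (?v n)) \<le> upper_mean f x"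
      unfolding upper_mean_def by (intro Liminf_le_Limsup) simp
    ultimately have eq: "liminf (\<lambda>n. ereal (?v n)) = upper_mean f x" by simp
    have "\<bar>upper_mean f x\<bar> \<noteq> \<infinity>"
      using elim(2,3) eq lower by (cases "upper_mean f x") auto
    then obtain l where l: "upper_mean f x = ereal l" by auto
    have "(\<lambda>n. ereal (?v n)) \<longlonglongrightarrow> ereal l"
      using eq l by (intro Liminf_eq_Limsup) (auto simp: upper_mean_def)
    then show ?case by (auto simp: convergent_def)
  qed
qed

end

section \<open>Integrals and means over intervals\<close>

lemma set_integral_combine_intervals:
  fixes h :: "real \<Rightarrow> real"
  assumes "set_integrable lborel {a..c} h" "a \<le> b" "b \<le> c"
  shows "(LINT t:{a..c}|lborel. h t) = (LINT t:{a..b}|lborel. h t) + (LINT t:{b..c}|lborel. h t)"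
proof -
  have "{a..c} = {a..b} \<union> {b..c}" using assms by auto
  moreover have "AE t in lborel. t \<noteq> b" by (rule AE_lborel_singleton)
  then have "AE t in lborel. \<not> (t \<in> {a..b} \<and> t \<in> {b..c})" by eventually_elim auto
  moreover have "set_integrable lborel {a..b} h" "set_integrable lborel {b..c} h"
    using assms by (auto intro: set_integrable_subset[OF assms(1)])
  ultimately show ?thesis by (simp add: set_integral_Un_AE)
qed

lemma set_integral_translate:
  fixes h :: "real \<Rightarrow> real"
  shows "(LINT t:{a..b}|lborel. h (t + s)) = (LINT t:{a+s..b+s}|lborel. h t)"
  unfolding set_lebesgue_integral_def
  by (subst (2) lborel_integral_real_affine[where c=1 and t=s])
     (auto intro!: Bochner_Integration.integral_cong simp: add.commute split: split_indicator)

text \<open>Monotonicity compares \<open>I t / t\<close> with the values of \<open>I\<close> at the two integers around \<open>t\<close>, and the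
quotients of these integers by \<open>t\<close> tend to \<open>1\<close>. This is how convergence along the integers, which is all
that discrete time provides, yields convergence along real times.\<close>

lemma tendsto_mean_interpolate:
  fixes I :: "real \<Rightarrow> real"
  assumes mono: "\<And>s t. 0 \<le> s \<Longrightarrow> s \<le> t \<Longrightarrow> I s \<le> I t" and nonneg: "\<And>t. 0 \<le> t \<Longrightarrow> 0 \<le> I t"
    and lim: "(\<lambda>n. I (real n) / real n) \<longlonglongrightarrow> l"
  shows "((\<lambda>t. I t / t) \<longlongrightarrow> l) at_top"
proof (rule tendsto_sandwich)
  let ?n = "\<lambda>t::real. nat \<lfloor>t\<rfloor>"
  have n: "filterlim ?n sequentially at_top"
    by (intro filterlim_compose[OF filterlim_nat_sequentially] filterlim_floor_sequentially)
  have bounds: "real (?n t) \<le> t" "t \<le> real (Suc (?n t))" if "t > 0" for t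
    using that by linarith+
  have lim_inv: "((\<lambda>t::real. c / t) \<longlongrightarrow> 0) at_top" for c
    by (intro tendsto_divide_0[OF tendsto_const] filterlim_at_top_imp_at_infinity filterlim_ident)
  have ratio: "((\<lambda>t. real (?n t) / t) \<longlongrightarrow> 1) at_top"
  proof (rule tendsto_sandwich)
    show "\<forall>\<^sub>F t in at_top. 1 - 1 / t \<le> real (?n t) / t"
      using eventually_gt_at_top[of 0]
    proof eventually_elim
      case (elim t)
      then have "1 - 1 / t = (t - 1) / t" by (simp add: diff_divide_distrib)
      also have "\<dots> \<le> real (?n t) / t" using bounds[OF elim] elim by (intro divide_right_mono) auto
      finally show ?case .
    qed
    show "\<forall>\<^sub>F t in at_top. real (?n t) / t \<le> 1"
      using eventually_gt_at_top[of 0]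
      by eventually_elim (use bounds in \<open>simp add: divide_le_eq_1\<close>)
    show "((\<lambda>t::real. 1 - 1 / t) \<longlongrightarrow> 1) at_top"
      using tendsto_diff[OF tendsto_const lim_inv[of 1], of 1] by simp
  qed simp
  have ratio': "((\<lambda>t. real (Suc (?n t)) / t) \<longlongrightarrow> 1) at_top"
    using tendsto_add[OF ratio lim_inv[of 1]] by (simp add: add_divide_distrib add.commute)
  show "((\<lambda>t. I (real (?n t)) / real (?n t) * (real (?n t) / t)) \<longlongrightarrow> l) at_top"
    using tendsto_mult[OF filterlim_compose[OF lim n] ratio] by simp
  have n': "filterlim (\<lambda>t. Suc (?n t)) sequentially at_top"
    by (rule filterlim_compose[OF filterlim_Suc n])
  show "((\<lambda>t. I (real (Suc (?n t))) / real (Suc (?n t)) * (real (Suc (?n t)) / t)) \<longlongrightarrow> l) at_top"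
    using tendsto_mult[OF filterlim_compose[OF lim n'] ratio'] by (simp del: of_nat_Suc)
  show "\<forall>\<^sub>F t in at_top. I (real (?n t)) / real (?n t) * (real (?n t) / t) \<le> I t / t"
    using eventually_gt_at_top[of 0]
  proof eventually_elim
    case (elim t)
    then have "I (real (?n t)) / t \<le> I t / t"
      using bounds[OF elim] by (intro divide_right_mono mono) auto
    then show ?case using elim nonneg[of t] by auto
  qed
  show "\<forall>\<^sub>F t in at_top. I t / t \<le> I (real (Suc (?n t))) / real (Suc (?n t)) * (real (Suc (?n t)) / t)"
    using eventually_gt_at_top[of 0]
  proof eventually_elim
    case (elim t)
    then have "I t / t \<le> I (real (Suc (?n t))) / t"
      using bounds[OF elim] by (intro divide_right_mono mono) auto
    then show ?case by (simp del: of_nat_Suc)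
  qed
qed

section \<open>Measure preserving flows\<close>

locale measure_preserving_flow = prob_space M for M :: "'a measure" +
  fixes \<phi> :: "real \<Rightarrow> 'a \<Rightarrow> 'a"
  assumes flow_measurable: "case_prod \<phi> \<in> borel \<Otimes>\<^sub>M M \<rightarrow>\<^sub>M M"
    and flow_zero: "\<And>x. x \<in> space M \<Longrightarrow> \<phi> 0 x = x"
    and flow_add: "\<And>s t x. x \<in> space M \<Longrightarrow> \<phi> (s + t) x = \<phi> s (\<phi> t x)"
    and distr_flow: "\<And>t. distr M M (\<phi> t) = M"
begin

lemma flow_measurable' [measurable]: "case_prod \<phi> \<in> lborel \<Otimes>\<^sub>M M \<rightarrow>\<^sub>M M"
  using flow_measurable by (simp cong: measurable_cong_sets sets_pair_measure_cong)

lemma time_map_measurable [measurable]: "\<phi> t \<in> M \<rightarrow>\<^sub>M M"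
  using measurable_Pair2[OF flow_measurable, of t] by simp

lemma orbit_measurable: "x \<in> space M \<Longrightarrow> (\<lambda>t. \<phi> t x) \<in> borel \<rightarrow>\<^sub>M M"
  using measurable_Pair1[OF flow_measurable, of x] by simp

lemma flow_space: "x \<in> space M \<Longrightarrow> \<phi> t x \<in> space M"
  using measurable_space[OF time_map_measurable] .

lemma reverse_flow: "measure_preserving_flow M (\<lambda>t. \<phi> (- t))"
proof
  have "(\<lambda>(t, x). (- t, x)) \<in> borel \<Otimes>\<^sub>M M \<rightarrow>\<^sub>M (borel :: real measure) \<Otimes>\<^sub>M M"
    by measurable
  from measurable_compose[OF this flow_measurable]
  show "(\<lambda>(t, x). \<phi> (- t) x) \<in> borel \<Otimes>\<^sub>M M \<rightarrow>\<^sub>M M"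
    by (simp add: case_prod_beta)
  show "\<phi> (- (s + t)) x = \<phi> (- s) (\<phi> (- t) x)" if "x \<in> space M" for s t x
    using flow_add[OF that, of "- s" "- t"] by simp
qed (simp_all add: flow_zero distr_flow)

sublocale lborel_M: pair_sigma_finite lborel M ..

text \<open>By Tonelli the order of integration may be exchanged, and for each fixed time the inner integral is
that of \<open>g\<close>. The identity is used with null sets, with integrable functions
along bounded intervals, and for the integrals of the means.\<close>

lemma nn_integral_orbit:
  assumes [measurable]: "g \<in> borel_measurable M" "A \<in> sets borel"
  shows "(\<integral>\<^sup>+x. (\<integral>\<^sup>+t. g (\<phi> t x) * indicator A t \<partial>lborel) \<partial>M)
    = emeasure lborel A * (\<integral>\<^sup>+x. g x \<partial>M)"
proof -
  have "(\<integral>\<^sup>+x. (\<integral>\<^sup>+t. g (\<phi> t x) * indicator A t \<partial>lborel) \<partial>M)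
      = (\<integral>\<^sup>+t. (\<integral>\<^sup>+x. g (\<phi> t x) * indicator A t \<partial>M) \<partial>lborel)"
    by (rule lborel_M.Fubini') measurable
  also have "\<dots> = (\<integral>\<^sup>+t. (\<integral>\<^sup>+x. g x \<partial>M) * indicator A t \<partial>lborel)"
  proof (rule nn_integral_cong)
    fix t
    have "(\<integral>\<^sup>+x. g (\<phi> t x) \<partial>M) = (\<integral>\<^sup>+x. g x \<partial>distr M M (\<phi> t))"
      by (rule nn_integral_distr[symmetric]) measurable
    then show "(\<integral>\<^sup>+x. g (\<phi> t x) * indicator A t \<partial>M) = (\<integral>\<^sup>+x. g x \<partial>M) * indicator A t"
      by (simp add: nn_integral_multc distr_flow)
  qed
  also have "\<dots> = emeasure lborel A * (\<integral>\<^sup>+x. g x \<partial>M)"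
    by (subst nn_integral_cmult_indicator) (simp_all add: mult.commute)
  finally show ?thesis .
qed

text \<open>Almost every orbit spends Lebesgue almost no time in a null set. Hence a function may be modified on
a null set without affecting its means along almost every orbit.\<close>

lemma AE_orbit:
  assumes "AE x in M. P x"
  shows "AE x in M. AE t in lborel. P (\<phi> t x)"
proof -
  obtain N where N: "{x\<in>space M. \<not> P x} \<subseteq> N" "emeasure M N = 0" and [measurable]: "N \<in> sets M"
    using assms by (rule AE_E)
  have "(\<integral>\<^sup>+x. (\<integral>\<^sup>+t. indicator N (\<phi> t x) * indicator UNIV t \<partial>lborel) \<partial>M) = 0"
    using nn_integral_orbit[of "indicator N" UNIV] N by simp
  then have "AE x in M. (\<integral>\<^sup>+t. indicator N (\<phi> t x) \<partial>lborel) = 0"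
    by (subst (asm) nn_integral_0_iff_AE) simp_all
  then show ?thesis
    using AE_space
  proof eventually_elim
    case (elim x)
    have [measurable]: "(\<lambda>t. \<phi> t x) \<in> borel \<rightarrow>\<^sub>M M" by (rule orbit_measurable[OF elim(2)])
    have "AE t in lborel. indicator N (\<phi> t x) = (0::ennreal)"
      using elim(1) by (subst (asm) nn_integral_0_iff_AE) simp_all
    then show ?case
    proof eventually_elim
      case (elim t)
      then show ?case
        using N(1) flow_space[OF \<open>x \<in> space M\<close>, of t] by (auto simp: indicator_def split: if_splits)
    qed
  qed
qed

definition orbit_integrable :: "('a \<Rightarrow> 'b::{banach, second_countable_topology}) \<Rightarrow> 'a \<Rightarrow> bool" where
  "orbit_integrable f x \<longleftrightarrow> (\<forall>a b. set_integrable lborel {a..b} (\<lambda>t. f (\<phi> t x)))"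

lemma orbit_integrableD: "orbit_integrable f x \<Longrightarrow> set_integrable lborel {a..b} (\<lambda>t. f (\<phi> t x))"
  by (simp add: orbit_integrable_def)

text \<open>On each interval \<open>[-n, n]\<close> the integral of \<open>norm f\<close> along the orbit has finite expectation.\<close>

lemma AE_orbit_integrable:
  fixes f :: "'a \<Rightarrow> 'b::{banach, second_countable_topology}"
  assumes f: "integrable M f"
  shows "AE x in M. orbit_integrable f x"
proof -
  have [measurable]: "f \<in> borel_measurable M" using f by auto
  have "AE x in M. \<forall>n::nat. (\<integral>\<^sup>+t. ennreal (norm (f (\<phi> t x))) * indicator {- real n..real n} t \<partial>lborel) < \<infinity>"
  proof (subst AE_all_countable, rule allI)
    fix n :: nat
    have "(\<integral>\<^sup>+x. (\<integral>\<^sup>+t. ennreal (norm (f (\<phi> t x))) * indicator {- real n..real n} t \<partial>lborel) \<partial>M)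
        = emeasure lborel {- real n..real n} * (\<integral>\<^sup>+x. ennreal (norm (f x)) \<partial>M)"
      by (rule nn_integral_orbit) auto
    also have "\<dots> < \<infinity>"
      using f by (auto simp: integrable_iff_bounded ennreal_mult_less_top)
    finally have "AE x in M. (\<integral>\<^sup>+t. ennreal (norm (f (\<phi> t x))) * indicator {- real n..real n} t \<partial>lborel) \<noteq> \<infinity>"
      by (intro nn_integral_PInf_AE) simp_all
    then show "AE x in M. (\<integral>\<^sup>+t. ennreal (norm (f (\<phi> t x))) * indicator {- real n..real n} t \<partial>lborel) < \<infinity>"
      by (simp add: less_top)
  qed
  then show ?thesis
    using AE_space
  proof eventually_elim
    case (elim x)
    have [measurable]: "(\<lambda>t. \<phi> t x) \<in> borel \<rightarrow>\<^sub>M M" by (rule orbit_measurable[OF elim(2)])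
    have n: "set_integrable lborel {- real n..real n} (\<lambda>t. f (\<phi> t x))" for n :: nat
      unfolding set_integrable_def
    proof (rule integrableI_bounded)
      have "(\<integral>\<^sup>+t. ennreal (norm (indicator {- real n..real n} t *\<^sub>R f (\<phi> t x))) \<partial>lborel)
          = (\<integral>\<^sup>+t. ennreal (norm (f (\<phi> t x))) * indicator {- real n..real n} t \<partial>lborel)"
        by (intro nn_integral_cong) (auto simp: indicator_def)
      then show "(\<integral>\<^sup>+t. ennreal (norm (indicator {- real n..real n} t *\<^sub>R f (\<phi> t x))) \<partial>lborel) < \<infinity>"
        using elim(1) by simp
    qed measurable
    have "set_integrable lborel {a..b} (\<lambda>t. f (\<phi> t x))" for a b
    proof -
      obtain k :: nat where "max \<bar>a\<bar> \<bar>b\<bar> \<le> real k" using real_arch_simple by blast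
      then show ?thesis by (intro set_integrable_subset[OF n[of k]]) auto
    qed
    then show ?case by (simp add: orbit_integrable_def)
  qed
qed

text \<open>The integral of \<open>f\<close> along \<open>[0, n]\<close> is the \<open>n\<close>-th Birkhoff sum, under the time-one map, of the integral
\<open>u\<close> of \<open>f\<close> along \<open>[0, 1]\<close>. Discrete Birkhoff gives convergence along the integers; as \<open>f\<close> is
nonnegative, the integral along \<open>[0, T]\<close> is monotone in \<open>T\<close> and real times can be interpolated.\<close>

lemma forward_mean_converges:
  fixes f :: "'a \<Rightarrow> real"
  assumes f: "integrable M f" and nonneg: "\<And>x. x \<in> space M \<Longrightarrow> 0 \<le> f x"
  shows "AE x in M. \<exists>l. ((\<lambda>T. (LINT t:{0..T}|lborel. f (\<phi> t x)) / T) \<longlongrightarrow> l) at_top"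
proof -
  have [measurable]: "f \<in> borel_measurable M" using f by auto
  define u where "u = (\<lambda>x. LINT t:{0..1}|lborel. f (\<phi> t x))"
  interpret time_one: measure_preserving_map M "\<phi> 1"
    by unfold_locales (simp_all add: distr_flow)
  have u: "integrable M u"
  proof (rule integrableI_bounded)
    show [measurable]: "u \<in> borel_measurable M"
      unfolding u_def set_lebesgue_integral_def by measurable
    have "(\<integral>\<^sup>+x. ennreal (norm (u x)) \<partial>M)
        \<le> (\<integral>\<^sup>+x. (\<integral>\<^sup>+t. ennreal (norm (f (\<phi> t x))) * indicator {0..1} t \<partial>lborel) \<partial>M)"
    proof (rule nn_integral_mono_AE)
      show "AE x in M. ennreal (norm (u x)) \<le> (\<integral>\<^sup>+t. ennreal (norm (f (\<phi> t x))) * indicator {0..1} t \<partial>lborel)"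
        using AE_orbit_integrable[OF f]
      proof eventually_elim
        case (elim x)
        have "ennreal (norm (u x)) \<le> (\<integral>\<^sup>+t. ennreal (norm (indicator {0..1} t *\<^sub>R f (\<phi> t x))) \<partial>lborel)"
          unfolding u_def set_lebesgue_integral_def
          using orbit_integrableD[OF elim, of 0 1]
          by (intro integral_norm_bound_ennreal) (simp add: set_integrable_def)
        also have "\<dots> = (\<integral>\<^sup>+t. ennreal (norm (f (\<phi> t x))) * indicator {0..1} t \<partial>lborel)"
          by (intro nn_integral_cong) (auto simp: indicator_def)
        finally show ?case .
      qed
    qed
    also have "\<dots> = emeasure lborel {0..1::real} * (\<integral>\<^sup>+x. ennreal (norm (f x)) \<partial>M)"
      by (rule nn_integral_orbit) auto
    also have "\<dots> < \<infinity>"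
      using f by (auto simp: integrable_iff_bounded ennreal_mult_less_top)
    finally show "(\<integral>\<^sup>+x. ennreal (norm (u x)) \<partial>M) < \<infinity>" .
  qed
  show ?thesis
    using time_one.birkhoff[OF u] AE_orbit_integrable[OF f] AE_space
  proof eventually_elim
    case (elim x)
    define I where "I = (\<lambda>T. LINT t:{0..T}|lborel. f (\<phi> t x))"
    note int = orbit_integrableD[OF elim(2)]
    \<comment> \<open>The starting time is arbitrary because the recursion of the sums moves it by one.\<close>
    have sum: "time_one.birkhoff_sum u n (\<phi> s x) = (LINT t:{s..s + real n}|lborel. f (\<phi> t x))" for n s
    proof (induction n arbitrary: s)
      case 0
      have "(LINT t:{s..s}|lborel. f (\<phi> t x)) = (LINT t:{}|lborel. f (\<phi> t x))"
        by (rule set_integral_discrete_difference[of "{s}"]) auto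
      then show ?case by (simp add: set_lebesgue_integral_def)
    next
      case (Suc n)
      have "u (\<phi> s x) = (LINT t:{0..1}|lborel. f (\<phi> (t + s) x))"
        unfolding u_def using flow_add[OF elim(3)] by simp
      also have "\<dots> = (LINT t:{s..s+1}|lborel. f (\<phi> t x))"
        using set_integral_translate[of 0 1 "\<lambda>t. f (\<phi> t x)" s] by (simp add: add.commute)
      finally have "u (\<phi> s x) = (LINT t:{s..s+1}|lborel. f (\<phi> t x))" .
      moreover have "\<phi> 1 (\<phi> s x) = \<phi> (s + 1) x"
        using flow_add[OF elim(3), of 1 s] by (simp add: add.commute)
      moreover have "(LINT t:{s..s + real (Suc n)}|lborel. f (\<phi> t x))
          = (LINT t:{s..s+1}|lborel. f (\<phi> t x)) + (LINT t:{s+1..s + real (Suc n)}|lborel. f (\<phi> t x))"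
        by (rule set_integral_combine_intervals[OF int]) auto
      ultimately show ?case using Suc[of "s + 1"] by (simp add: add.assoc)
    qed
    obtain l where l: "(\<lambda>n. time_one.birkhoff_sum u n x / real n) \<longlonglongrightarrow> l"
      using elim(1) by (auto simp: convergent_def)
    have "(\<lambda>n. I (real n) / real n) \<longlonglongrightarrow> l"
      using l sum[of _ 0] flow_zero[OF elim(3)] by (simp add: I_def)
    moreover have I_nonneg: "0 \<le> (LINT t:{a..b}|lborel. f (\<phi> t x))" for a b
      unfolding set_lebesgue_integral_def
      by (intro integral_nonneg_AE) (auto simp: nonneg flow_space elim)
    moreover have "I s \<le> I t" if "0 \<le> s" "s \<le> t" for s t
      using set_integral_combine_intervals[OF int that] I_nonneg[of s t] by (simp add: I_def)
    ultimately have "((\<lambda>T. I T / T) \<longlongrightarrow> l) at_top"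
      by (intro tendsto_mean_interpolate) (auto simp: I_def)
    then show ?case unfolding I_def by blast
  qed
qed

definition orbit_mean :: "('a \<Rightarrow> 'b::{banach, second_countable_topology}) \<Rightarrow> 'a \<Rightarrow> real \<Rightarrow> 'b" where
  "orbit_mean f x T = (1 / (2 * T)) *\<^sub>R (LINT t:{-T..T}|lborel. f (\<phi> t x))"

text \<open>The mean over \<open>[-T, T]\<close> is half the sum of the one-sided means of the flow and of its reversal.\<close>

lemma orbit_mean_converges_nonneg:
  fixes f :: "'a \<Rightarrow> real"
  assumes f: "integrable M f" and nonneg: "\<And>x. x \<in> space M \<Longrightarrow> 0 \<le> f x"
  shows "AE x in M. \<exists>l. (orbit_mean f x \<longlongrightarrow> l) at_top"
proof -
  interpret reverse: measure_preserving_flow M "\<lambda>t. \<phi> (- t)" by (rule reverse_flow)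
  have "AE x in M. \<exists>l. ((\<lambda>T. (LINT t:{0..T}|lborel. f (\<phi> t x)) / T) \<longlongrightarrow> l) at_top"
    by (rule forward_mean_converges) (use f nonneg in auto)
  moreover have "AE x in M. \<exists>l. ((\<lambda>T. (LINT t:{0..T}|lborel. f (\<phi> (- t) x)) / T) \<longlongrightarrow> l) at_top"
    by (rule reverse.forward_mean_converges) (use f nonneg in auto)
  ultimately show ?thesis
    using AE_orbit_integrable[OF f]
  proof eventually_elim
    case (elim x)
    obtain l where l: "((\<lambda>T. (LINT t:{0..T}|lborel. f (\<phi> t x)) / T) \<longlongrightarrow> l) at_top"
      using elim by blast
    obtain l' where l': "((\<lambda>T. (LINT t:{0..T}|lborel. f (\<phi> (- t) x)) / T) \<longlongrightarrow> l') at_top"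
      using elim by blast
    have "((\<lambda>T. 1/2 * ((LINT t:{0..T}|lborel. f (\<phi> (- t) x)) / T
        + (LINT t:{0..T}|lborel. f (\<phi> t x)) / T)) \<longlongrightarrow> 1/2 * (l' + l)) at_top"
      by (intro tendsto_intros l l')
    moreover have "\<forall>\<^sub>F T in at_top. 1/2 * ((LINT t:{0..T}|lborel. f (\<phi> (- t) x)) / T
        + (LINT t:{0..T}|lborel. f (\<phi> t x)) / T) = orbit_mean f x T"
      using eventually_gt_at_top[of 0]
    proof eventually_elim
      case (elim T)
      have "(LINT t:{-T..0}|lborel. f (\<phi> t x)) = (LINT t:{0..T}|lborel. f (\<phi> (- t) x))"
        by (subst set_integral_reflect) (auto intro!: arg_cong[where f="\<lambda>A. set_lebesgue_integral lborel A _"])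
      moreover have "(LINT t:{-T..T}|lborel. f (\<phi> t x))
          = (LINT t:{-T..0}|lborel. f (\<phi> t x)) + (LINT t:{0..T}|lborel. f (\<phi> t x))"
        using elim \<open>orbit_integrable f x\<close>
        by (intro set_integral_combine_intervals orbit_integrableD) auto
      ultimately show ?case using elim by (simp add: orbit_mean_def field_simps)
    qed
    ultimately have "(orbit_mean f x \<longlongrightarrow> 1/2 * (l' + l)) at_top"
      by (rule Lim_transform_eventually)
    then show ?case by blast
  qed
qed

lemma orbit_mean_converges_real:
  fixes f :: "'a \<Rightarrow> real"
  assumes f: "integrable M f"
  shows "AE x in M. \<exists>l. (orbit_mean f x \<longlongrightarrow> l) at_top"
proof -
  let ?p = "\<lambda>x. max 0 (f x)" and ?n = "\<lambda>x. max 0 (- f x)"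
  have p: "integrable M ?p" and n: "integrable M ?n" using f by auto
  have "AE x in M. \<exists>l. (orbit_mean ?p x \<longlongrightarrow> l) at_top" "AE x in M. \<exists>l. (orbit_mean ?n x \<longlongrightarrow> l) at_top"
    using p n by (auto intro!: orbit_mean_converges_nonneg)
  then show ?thesis
    using AE_orbit_integrable[OF p] AE_orbit_integrable[OF n]
  proof eventually_elim
    case (elim x)
    obtain a b where "(orbit_mean ?p x \<longlongrightarrow> a) at_top" "(orbit_mean ?n x \<longlongrightarrow> b) at_top"
      using elim by blast
    then have "((\<lambda>T. orbit_mean ?p x T - orbit_mean ?n x T) \<longlongrightarrow> a - b) at_top"
      by (intro tendsto_diff)
    moreover have "orbit_mean ?p x T - orbit_mean ?n x T = orbit_mean f x T" for T
    proof -
      have "(LINT t:{-T..T}|lborel. f (\<phi> t x)) = (LINT t:{-T..T}|lborel. ?p (\<phi> t x) - ?n (\<phi> t x))"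
        by (intro arg_cong[where f="set_lebesgue_integral lborel _"]) (auto simp: fun_eq_iff max_def)
      also have "\<dots> = (LINT t:{-T..T}|lborel. ?p (\<phi> t x)) - (LINT t:{-T..T}|lborel. ?n (\<phi> t x))"
        using elim(3,4) by (intro set_integral_diff orbit_integrableD)
      finally show ?thesis by (simp add: orbit_mean_def diff_divide_distrib)
    qed
    ultimately show ?case by auto
  qed
qed

theorem orbit_mean_converges:
  fixes f :: "'a \<Rightarrow> complex"
  assumes f: "integrable M f"
  shows "AE x in M. \<exists>l. (orbit_mean f x \<longlongrightarrow> l) at_top"
proof -
  have "AE x in M. \<exists>l. (orbit_mean (\<lambda>x. Re (f x)) x \<longlongrightarrow> l) at_top"
    "AE x in M. \<exists>l. (orbit_mean (\<lambda>x. Im (f x)) x \<longlongrightarrow> l) at_top"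
    using f by (auto intro!: orbit_mean_converges_real)
  then show ?thesis
    using AE_orbit_integrable[OF f]
  proof eventually_elim
    case (elim x)
    obtain a b where "(orbit_mean (\<lambda>x. Re (f x)) x \<longlongrightarrow> a) at_top"
      "(orbit_mean (\<lambda>x. Im (f x)) x \<longlongrightarrow> b) at_top"
      using elim by blast
    then have "((\<lambda>T. Complex (orbit_mean (\<lambda>x. Re (f x)) x T) (orbit_mean (\<lambda>x. Im (f x)) x T))
        \<longlongrightarrow> Complex a b) at_top"
      by (rule tendsto_Complex)
    moreover have "Complex (orbit_mean (\<lambda>x. Re (f x)) x T) (orbit_mean (\<lambda>x. Im (f x)) x T) = orbit_mean f x T" for T
      using orbit_integrableD[OF elim(3), of "-T" T]
      by (auto simp: complex_eq_iff orbit_mean_def set_lebesgue_integral_def set_integrable_def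
          simp flip: integral_Re integral_Im)
    ultimately show ?case by auto
  qed
qed

text \<open>The lower limit of the means of a nonnegative function along integer times. The limit of the orbit
means is only defined almost everywhere; this version is measurable by construction, so that Fatou's
lemma applies to it.\<close>

definition lower_orbit_mean :: "('a \<Rightarrow> real) \<Rightarrow> 'a \<Rightarrow> ennreal" where
  "lower_orbit_mean f x = liminf (\<lambda>n. ennreal (1 / (2 * real (Suc n))) *
     (\<integral>\<^sup>+t. ennreal (f (\<phi> t x)) * indicator {- real (Suc n)..real (Suc n)} t \<partial>lborel))"

lemma borel_measurable_lower_orbit_mean [measurable]:
  assumes [measurable]: "f \<in> borel_measurable M"
  shows "lower_orbit_mean f \<in> borel_measurable M"
  unfolding lower_orbit_mean_def by measurable

text \<open>Fatou's lemma: every mean over a fixed interval has the same integral as \<open>f\<close>, by \<open>nn_integral_orbit\<close>.\<close>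

lemma nn_integral_lower_orbit_mean_le:
  assumes [measurable]: "f \<in> borel_measurable M"
  shows "(\<integral>\<^sup>+x. lower_orbit_mean f x \<partial>M) \<le> (\<integral>\<^sup>+x. ennreal (f x) \<partial>M)"
proof -
  let ?a = "\<lambda>n x. ennreal (1 / (2 * real (Suc n))) *
     (\<integral>\<^sup>+t. ennreal (f (\<phi> t x)) * indicator {- real (Suc n)..real (Suc n)} t \<partial>lborel)"
  have "(\<integral>\<^sup>+x. lower_orbit_mean f x \<partial>M) \<le> liminf (\<lambda>n. \<integral>\<^sup>+x. ?a n x \<partial>M)"
    unfolding lower_orbit_mean_def by (rule nn_integral_liminf) measurable
  also have "(\<lambda>n. \<integral>\<^sup>+x. ?a n x \<partial>M) = (\<lambda>n. \<integral>\<^sup>+x. ennreal (f x) \<partial>M)"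
  proof
    fix n
    let ?A = "{- real (Suc n)..real (Suc n)}"
    have "(\<integral>\<^sup>+x. ?a n x \<partial>M) = ennreal (1 / (2 * real (Suc n))) *
        (\<integral>\<^sup>+x. (\<integral>\<^sup>+t. ennreal (f (\<phi> t x)) * indicator ?A t \<partial>lborel) \<partial>M)"
      by (rule nn_integral_cmult) measurable
    also have "(\<integral>\<^sup>+x. (\<integral>\<^sup>+t. ennreal (f (\<phi> t x)) * indicator ?A t \<partial>lborel) \<partial>M)
        = emeasure lborel ?A * (\<integral>\<^sup>+x. ennreal (f x) \<partial>M)"
      by (rule nn_integral_orbit) measurable
    also have "emeasure lborel ?A = ennreal (2 * real (Suc n))"
      by (subst emeasure_lborel_Icc) (simp_all del: of_nat_Suc)
    also have "ennreal (1 / (2 * real (Suc n))) * (ennreal (2 * real (Suc n)) * (\<integral>\<^sup>+x. ennreal (f x) \<partial>M))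
        = ennreal (1 / (2 * real (Suc n)) * (2 * real (Suc n))) * (\<integral>\<^sup>+x. ennreal (f x) \<partial>M)"
      by (subst ennreal_mult) (simp_all only: mult.assoc zero_le_mult_iff zero_le_divide_iff of_nat_0_le_iff zero_le_numeral zero_le_one simp_thms)
    also have "1 / (2 * real (Suc n)) * (2 * real (Suc n)) = 1"
      by (simp del: of_nat_Suc)
    also have "ennreal 1 * (\<integral>\<^sup>+x. ennreal (f x) \<partial>M) = (\<integral>\<^sup>+x. ennreal (f x) \<partial>M)"
      by simp
    finally show "(\<integral>\<^sup>+x. ?a n x \<partial>M) = (\<integral>\<^sup>+x. ennreal (f x) \<partial>M)" .
  qed
  finally show ?thesis by (simp add: Liminf_const)
qed

lemma lower_orbit_mean_eq:
  assumes x: "x \<in> space M" and int: "orbit_integrable f x"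
    and nonneg: "\<And>x. x \<in> space M \<Longrightarrow> 0 \<le> f x" and lim: "(orbit_mean f x \<longlongrightarrow> l) at_top"
  shows "lower_orbit_mean f x = ennreal l"
proof -
  have eq: "ennreal (1 / (2 * real (Suc n))) *
     (\<integral>\<^sup>+t. ennreal (f (\<phi> t x)) * indicator {- real (Suc n)..real (Suc n)} t \<partial>lborel)
    = ennreal (orbit_mean f x (real (Suc n)))" for n
  proof -
    let ?A = "{- real (Suc n)..real (Suc n)}"
    have "(\<integral>\<^sup>+t. ennreal (f (\<phi> t x)) * indicator ?A t \<partial>lborel)
        = (\<integral>\<^sup>+t. ennreal (indicator ?A t *\<^sub>R f (\<phi> t x)) \<partial>lborel)"
      by (intro nn_integral_cong) (auto simp: indicator_def)
    also have "\<dots> = ennreal (LINT t:?A|lborel. f (\<phi> t x))"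
      unfolding set_lebesgue_integral_def
      using orbit_integrableD[OF int, of "- real (Suc n)" "real (Suc n)"]
      by (intro nn_integral_eq_integral) (auto simp: set_integrable_def nonneg flow_space x)
    finally show ?thesis
      by (simp add: orbit_mean_def ennreal_mult'[symmetric] del: of_nat_Suc)
  qed
  have "(\<lambda>n. ennreal (orbit_mean f x (real (Suc n)))) \<longlonglongrightarrow> ennreal l"
    by (intro tendsto_ennrealI filterlim_compose[OF lim]
        filterlim_compose[OF filterlim_real_sequentially filterlim_Suc])
  then show ?thesis
    unfolding lower_orbit_mean_def eq by (intro lim_imp_Liminf) auto
qed

lemma norm_orbit_mean_diff_le:
  fixes f f' :: "'a \<Rightarrow> complex"
  assumes "orbit_integrable f x" "orbit_integrable f' x" "orbit_integrable g x" and x: "x \<in> space M"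
    and le: "\<And>y. y \<in> space M \<Longrightarrow> norm (f y - f' y) \<le> g y" and "0 < T"
  shows "norm (orbit_mean f x T - orbit_mean f' x T) \<le> orbit_mean g x T"
proof -
  let ?I = "{-T..T}"
  have int: "set_integrable lborel ?I (\<lambda>t. f (\<phi> t x) - f' (\<phi> t x))"
    using assms(1,2) by (intro set_integral_diff orbit_integrableD)
  have "orbit_mean f x T - orbit_mean f' x T = (1 / (2 * T)) *\<^sub>R (LINT t:?I|lborel. f (\<phi> t x) - f' (\<phi> t x))"
    using assms(1,2) by (simp add: orbit_mean_def orbit_integrableD scaleR_diff_right)
  also have "norm \<dots> = (1 / (2 * T)) * norm (LINT t:?I|lborel. f (\<phi> t x) - f' (\<phi> t x))"
    using \<open>0 < T\<close> by simp
  also have "norm (LINT t:?I|lborel. f (\<phi> t x) - f' (\<phi> t x)) \<le> (LINT t:?I|lborel. norm (f (\<phi> t x) - f' (\<phi> t x)))"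
    by (rule set_integral_norm_bound[OF int])
  also have "\<dots> \<le> (LINT t:?I|lborel. g (\<phi> t x))"
    using assms(3) by (intro set_integral_mono orbit_integrableD le flow_space x set_integrable_norm int)
  finally show ?thesis using \<open>0 < T\<close> by (simp add: orbit_mean_def mult_left_mono divide_right_mono)
qed

text \<open>The functions \<open>g\<^sub>k = sup\<^sub>n\<^sub>\<ge>\<^sub>k |F\<^sub>n - F'|\<close> are dominated by \<open>2 G\<close> and tend to \<open>0\<close>, so their integrals tend to
\<open>0\<close>. The limits \<open>h\<^sub>k\<close> of their orbit means have no larger integral by Fatou's lemma, and a second use
of Fatou gives \<open>liminf h\<^sub>k = 0\<close> almost everywhere. For \<open>n \<ge> k\<close> the limits of the orbit means of \<open>F\<^sub>n\<close> and
\<open>F'\<close> are at distance at most \<open>h\<^sub>k\<close>, so a single small \<open>h\<^sub>k\<close> controls all later \<open>n\<close>.\<close>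

theorem dominated_convergence_orbit_mean:
  fixes F :: "nat \<Rightarrow> 'a \<Rightarrow> complex" and F' :: "'a \<Rightarrow> complex" and G :: "'a \<Rightarrow> real"
  assumes [measurable]: "\<And>n. F n \<in> borel_measurable M" "F' \<in> borel_measurable M"
    and G: "integrable M G"
    and bound: "\<And>n x. x \<in> space M \<Longrightarrow> norm (F n x) \<le> G x"
    and lim: "\<And>x. x \<in> space M \<Longrightarrow> (\<lambda>n. F n x) \<longlonglongrightarrow> F' x"
  shows "integrable M F'" "\<And>n. integrable M (F n)"
    "AE x in M. orbit_integrable F' x \<and> (\<forall>n. orbit_integrable (F n) x) \<and>
      (\<exists>L l. (\<forall>n. (orbit_mean (F n) x \<longlongrightarrow> L n) at_top) \<and> L \<longlonglongrightarrow> l \<and> (orbit_mean F' x \<longlongrightarrow> l) at_top)"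
proof -
  have bound': "norm (F' x) \<le> G x" if "x \<in> space M" for x
    using tendsto_norm[OF lim[OF that]] bound[OF that] by (intro LIMSEQ_le_const2) auto
  show intF: "integrable M (F n)" for n
    by (rule Bochner_Integration.integrable_bound[OF G]) (auto intro!: AE_I2 order.trans[OF bound])
  show intF': "integrable M F'"
    by (rule Bochner_Integration.integrable_bound[OF G]) (auto intro!: AE_I2 order.trans[OF bound'])
  have [measurable]: "G \<in> borel_measurable M" using G by auto
  define g where "g = (\<lambda>k x. SUP n. norm (F (n + k) x - F' x))"
  have diff_le: "norm (F n x - F' x) \<le> 2 * G x" if "x \<in> space M" for n x
    using bound[OF that, of n] bound'[OF that] norm_triangle_ineq4[of "F n x" "F' x"] by linarith
  have bdd: "bdd_above (range (\<lambda>n. norm (F (n + k) x - F' x)))" if "x \<in> space M" for k x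
    using diff_le[OF that] by (intro bdd_aboveI[of _ "2 * G x"]) auto
  have [measurable]: "g k \<in> borel_measurable M" for k
    unfolding g_def using bdd by (intro borel_measurable_cSUP) auto
  have le_g: "norm (F n x - F' x) \<le> g k x" if "x \<in> space M" "k \<le> n" for n k x
    using cSUP_upper[OF UNIV_I bdd[OF that(1), of k], of "n - k"] that(2) by (simp add: g_def)
  have g_le: "g k x \<le> 2 * G x" if "x \<in> space M" for k x
    unfolding g_def by (rule cSUP_least) (auto simp: diff_le that)
  have g_nonneg: "0 \<le> g k x" if "x \<in> space M" for k x
    using le_g[OF that order.refl, of k] norm_ge_zero order.trans by blast
  have intg: "integrable M (g k)" for k
    by (rule Bochner_Integration.integrable_bound[of M "\<lambda>x. 2 * G x"])
       (use G g_nonneg g_le in \<open>auto intro!: AE_I2 order.trans[OF g_le]\<close>)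
  have g_lim: "(\<lambda>k. g k x) \<longlonglongrightarrow> 0" if x: "x \<in> space M" for x
  proof (rule LIMSEQ_I)
    fix e :: real assume "0 < e"
    then obtain N where N: "\<And>n. n \<ge> N \<Longrightarrow> norm (F n x - F' x) < e / 2"
      using LIMSEQ_D[OF lim[OF x], of "e / 2"] by auto
    have "norm (g k x - 0) < e" if "k \<ge> N" for k
    proof -
      have "g k x \<le> e / 2"
        unfolding g_def using N that by (intro cSUP_least) (auto intro: less_imp_le)
      then show ?thesis using g_nonneg[OF x, of k] \<open>0 < e\<close> by simp
    qed
    then show "\<exists>no. \<forall>k\<ge>no. norm (g k x - 0) < e" by blast
  qed
  have "(\<lambda>k. LINT x|M. g k x) \<longlonglongrightarrow> (LINT x|M. 0)"
    using G g_nonneg g_le g_lim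
    by (intro integral_dominated_convergence[where w="\<lambda>x. 2 * G x"]) (auto intro!: AE_I2)
  then have "(\<lambda>k. ennreal (LINT x|M. g k x)) \<longlonglongrightarrow> ennreal 0"
    by (intro tendsto_ennrealI) simp
  moreover have "ennreal (LINT x|M. g k x) = (\<integral>\<^sup>+x. ennreal (g k x) \<partial>M)" for k
    using intg g_nonneg by (intro nn_integral_eq_integral[symmetric]) (auto intro!: AE_I2)
  ultimately have g_int_lim: "(\<lambda>k. \<integral>\<^sup>+x. ennreal (g k x) \<partial>M) \<longlonglongrightarrow> 0" by simp
  have "(\<integral>\<^sup>+x. liminf (\<lambda>k. lower_orbit_mean (g k) x) \<partial>M)
      \<le> liminf (\<lambda>k. \<integral>\<^sup>+x. lower_orbit_mean (g k) x \<partial>M)"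
    by (rule nn_integral_liminf) measurable
  also have "\<dots> \<le> liminf (\<lambda>k. \<integral>\<^sup>+x. ennreal (g k x) \<partial>M)"
    by (intro Liminf_mono always_eventually allI nn_integral_lower_orbit_mean_le) measurable
  also have "\<dots> = 0"
    using g_int_lim by (intro lim_imp_Liminf) auto
  finally have "(\<integral>\<^sup>+x. liminf (\<lambda>k. lower_orbit_mean (g k) x) \<partial>M) = 0" by simp
  then have "AE x in M. liminf (\<lambda>k. lower_orbit_mean (g k) x) = 0"
    by (subst (asm) nn_integral_0_iff_AE)
       (auto intro!: borel_measurable_liminf borel_measurable_lower_orbit_mean)
  moreover have "AE x in M. \<forall>k. \<exists>l. (orbit_mean (g k) x \<longlongrightarrow> l) at_top"
    using intg by (auto simp: AE_all_countable intro!: orbit_mean_converges_real)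
  moreover have "AE x in M. \<forall>n. \<exists>l. (orbit_mean (F n) x \<longlongrightarrow> l) at_top"
    using intF by (auto simp: AE_all_countable intro!: orbit_mean_converges)
  moreover have "AE x in M. \<exists>l. (orbit_mean F' x \<longlongrightarrow> l) at_top"
    by (rule orbit_mean_converges[OF intF'])
  moreover have "AE x in M. \<forall>n. orbit_integrable (F n) x"
    using intF by (auto simp: AE_all_countable intro!: AE_orbit_integrable)
  moreover have "AE x in M. \<forall>k. orbit_integrable (g k) x"
    using intg by (auto simp: AE_all_countable intro!: AE_orbit_integrable)
  moreover have "AE x in M. orbit_integrable F' x"
    by (rule AE_orbit_integrable[OF intF'])
  ultimately show "AE x in M. orbit_integrable F' x \<and> (\<forall>n. orbit_integrable (F n) x) \<and>
      (\<exists>L l. (\<forall>n. (orbit_mean (F n) x \<longlongrightarrow> L n) at_top) \<and> L \<longlonglongrightarrow> l \<and> (orbit_mean F' x \<longlongrightarrow> l) at_top)"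
    using AE_space
  proof eventually_elim
    case (elim x)
    obtain h where h: "\<And>k. (orbit_mean (g k) x \<longlongrightarrow> h k) at_top" using elim(2) by metis
    obtain L where L: "\<And>n. (orbit_mean (F n) x \<longlongrightarrow> L n) at_top" using elim(3) by metis
    obtain l where l: "(orbit_mean F' x \<longlongrightarrow> l) at_top" using elim(4) by blast
    have le: "norm (L n - l) \<le> h k" if "k \<le> n" for k n
    proof (rule tendsto_le[OF _ h tendsto_norm[OF tendsto_diff[OF L l]]])
      show "\<forall>\<^sub>F T in at_top. norm (orbit_mean (F n) x T - orbit_mean F' x T) \<le> orbit_mean (g k) x T"
        using eventually_gt_at_top[of 0]
        by eventually_elim (use elim that le_g in \<open>auto intro!: norm_orbit_mean_diff_le\<close>)
    qed simp
    have small: "\<exists>k. h k < e" if "0 < e" for e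
    proof (rule ccontr)
      assume "\<not> ?thesis"
      then have "ennreal e \<le> lower_orbit_mean (g k) x" for k
        using lower_orbit_mean_eq[OF elim(8) _ g_nonneg h] elim(6) by (auto simp: not_less ennreal_leI)
      then have "ennreal e \<le> liminf (\<lambda>k. lower_orbit_mean (g k) x)"
        by (intro Liminf_bounded) auto
      then show False using elim(1) that by (simp add: ennreal_eq_0_iff)
    qed
    have "L \<longlonglongrightarrow> l"
    proof (rule LIMSEQ_I)
      fix e :: real assume "0 < e"
      then obtain k where "h k < e" using small by blast
      then show "\<exists>no. \<forall>n\<ge>no. norm (L n - l) < e" using le le_less_trans by blast
    qed
    then show ?case using elim L l by blast
  qed
qed

end

section \<open>Haar measure on the torus and its translations\<close>

text \<open>The left-hand side is the measure of \<open>B\<close> in the window \<open>[\<theta>, p + \<theta>)\<close>. Its part beyond \<open>p\<close> is moved back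
by one period and fills the gap \<open>[0, \<theta>)\<close>.\<close>

lemma emeasure_periodic_shift:
  fixes B :: "real set"
  assumes [measurable]: "B \<in> sets borel" and periodic: "\<And>x. x + p \<in> B \<longleftrightarrow> x \<in> B"
    and \<theta>: "0 \<le> \<theta>" "\<theta> \<le> p"
  shows "emeasure lborel ({x. x + \<theta> \<in> B} \<inter> {0..<p}) = emeasure lborel (B \<inter> {0..<p})"
proof -
  have shift: "emeasure lborel S = emeasure lborel {x. c + x \<in> S}"
    if [measurable]: "S \<in> sets borel" for S and c :: real
  proof -
    have "emeasure lborel S = emeasure (distr lborel borel ((+) c)) S"
      by (simp add: lborel_distr_plus)
    also have "\<dots> = emeasure lborel ((+) c -` S \<inter> space lborel)"
      by (rule emeasure_distr) auto
    also have "(+) c -` S \<inter> space lborel = {x. c + x \<in> S}" by auto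
    finally show ?thesis .
  qed
  have "emeasure lborel ({x. x + \<theta> \<in> B} \<inter> {0..<p}) = emeasure lborel (B \<inter> {\<theta>..<p + \<theta>})"
    by (subst shift[of "B \<inter> {\<theta>..<p + \<theta>}" \<theta>])
       (auto intro!: arg_cong[where f="emeasure lborel"] simp: add.commute)
  also have "B \<inter> {\<theta>..<p + \<theta>} = (B \<inter> {\<theta>..<p}) \<union> (B \<inter> {p..<p + \<theta>})"
    using \<theta> by auto
  also have "emeasure lborel \<dots> = emeasure lborel (B \<inter> {\<theta>..<p}) + emeasure lborel (B \<inter> {p..<p + \<theta>})"
    by (intro plus_emeasure[symmetric]) auto
  also have "emeasure lborel (B \<inter> {p..<p + \<theta>}) = emeasure lborel (B \<inter> {0..<\<theta>})"
    by (subst shift[of _ p])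
       (auto intro!: arg_cong[where f="emeasure lborel"] simp: periodic add.commute[of p])
  also have "emeasure lborel (B \<inter> {\<theta>..<p}) + emeasure lborel (B \<inter> {0..<\<theta>})
      = emeasure lborel ((B \<inter> {\<theta>..<p}) \<union> (B \<inter> {0..<\<theta>}))"
    by (intro plus_emeasure) auto
  also have "(B \<inter> {\<theta>..<p}) \<union> (B \<inter> {0..<\<theta>}) = B \<inter> {0..<p}"
    using \<theta> by auto
  finally show ?thesis .
qed

lemma sets_circle_measure: "sets circle_measure = sets (restrict_space borel (sphere 0 1))"
  by (simp add: circle_measure_def)

lemma space_circle_measure: "space circle_measure = sphere 0 1"
  by (simp add: circle_measure_def space_restrict_space)

lemma sets_circle_measure_iff: "A \<in> sets circle_measure \<longleftrightarrow> A \<in> sets borel \<and> A \<subseteq> sphere 0 1"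
  by (auto simp: sets_circle_measure sets_restrict_space_iff)

lemma borel_measurable_cis [measurable]: "cis \<in> borel_measurable borel"
  by (intro borel_measurable_continuous_onI continuous_intros)

lemma cis_measurable_circle: "cis \<in> borel \<rightarrow>\<^sub>M restrict_space borel (sphere 0 1)"
  by (intro measurable_restrict_space2) auto

lemma prob_space_circle_measure: "prob_space circle_measure"
proof -
  have "prob_space (uniform_measure lborel {0..<2 * pi})"
    by (intro prob_space_uniform_measure) auto
  then show ?thesis
    unfolding circle_measure_def
    by (rule prob_space.prob_space_distr) (use cis_measurable_circle in simp)
qed

lemma emeasure_circle_measure:
  assumes "A \<in> sets circle_measure"
  shows "emeasure circle_measure A = emeasure lborel ({x. cis x \<in> A} \<inter> {0..<2 * pi}) / ennreal (2 * pi)"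
proof -
  have [measurable]: "A \<in> sets borel" using assms by (simp add: sets_circle_measure_iff)
  have "emeasure circle_measure A
      = emeasure (uniform_measure lborel {0..<2 * pi}) (cis -` A \<inter> space (uniform_measure lborel {0..<2 * pi}))"
    unfolding circle_measure_def
    by (rule emeasure_distr) (use cis_measurable_circle assms in \<open>simp_all add: sets_circle_measure\<close>)
  also have "cis -` A \<inter> space (uniform_measure lborel {0..<2 * pi}) = {x. cis x \<in> A}" by auto
  also have "emeasure (uniform_measure lborel {0..<2 * pi}) {x. cis x \<in> A}
      = emeasure lborel ({x. cis x \<in> A} \<inter> {0..<2 * pi}) / ennreal (2 * pi)"
    by (subst emeasure_uniform_measure) (auto simp: Int_commute)
  finally show ?thesis .
qed

lemma sets_circle_measure_rotate:
  assumes w: "w \<in> sphere 0 1" and A: "A \<in> sets circle_measure"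
  shows "{z \<in> sphere 0 1. z * w \<in> A} \<in> sets circle_measure"
proof -
  have [measurable]: "A \<in> sets borel" using A by (simp add: sets_circle_measure_iff)
  have "sphere 0 1 \<inter> {z. z * w \<in> A} \<in> sets borel" by (intro sets.Int) auto
  then show ?thesis by (auto simp: sets_circle_measure_iff Collect_conj_eq)
qed

lemma emeasure_circle_measure_rotate:
  assumes w: "w \<in> sphere 0 1" and A: "A \<in> sets circle_measure"
  shows "emeasure circle_measure {z \<in> sphere 0 1. z * w \<in> A} = emeasure circle_measure A"
proof -
  have [measurable]: "A \<in> sets borel" using A by (simp add: sets_circle_measure_iff)
  define \<theta> where "\<theta> = Arg2pi w"
  have \<theta>: "0 \<le> \<theta>" "\<theta> \<le> 2 * pi" "w = cis \<theta>"
    using Arg2pi[of w] w by (auto simp: \<theta>_def is_Arg_def cis_conv_exp)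
  have "emeasure circle_measure {z \<in> sphere 0 1. z * w \<in> A}
      = emeasure lborel ({x. x + \<theta> \<in> {x. cis x \<in> A}} \<inter> {0..<2 * pi}) / ennreal (2 * pi)"
    by (subst emeasure_circle_measure[OF sets_circle_measure_rotate[OF w A]]) (simp add: \<theta>(3) cis_mult)
  also have "emeasure lborel ({x. x + \<theta> \<in> {x. cis x \<in> A}} \<inter> {0..<2 * pi})
      = emeasure lborel ({x. cis x \<in> A} \<inter> {0..<2 * pi})"
  proof (rule emeasure_periodic_shift[OF _ _ \<theta>(1,2)])
    show "x + 2 * pi \<in> {x. cis x \<in> A} \<longleftrightarrow> x \<in> {x. cis x \<in> A}" for x
      by (simp flip: cis_mult)
  qed measurable
  also have "\<dots> / ennreal (2 * pi) = emeasure circle_measure A"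
    by (rule emeasure_circle_measure[OF A, symmetric])
  finally show ?thesis .
qed

text \<open>The product measure before completion. Joint measurability of the flow in time and space, on which
Tonelli's theorem rests, is available on the Borel sets of the torus, but need not hold on the completion.\<close>

definition borel_torus :: "(nat \<Rightarrow> complex) measure" where
  "borel_torus = (\<Pi>\<^sub>M n\<in>UNIV. circle_measure)"

lemma torus_haar_eq: "torus_haar = completion borel_torus"
  by (simp add: torus_haar_def borel_torus_def)

lemma space_borel_torus: "space borel_torus = {z. \<forall>n. z n \<in> sphere 0 1}"
  by (auto simp: borel_torus_def space_PiM space_circle_measure PiE_UNIV_domain)

interpretation circle_product: product_prob_space "\<lambda>_::nat. circle_measure" UNIV
  by (intro product_prob_spaceI prob_space_circle_measure)

lemma prob_space_borel_torus: "prob_space borel_torus"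
  unfolding borel_torus_def by unfold_locales

lemma coordinate_borel_measurable: "(\<lambda>z. z n) \<in> borel_measurable borel_torus"
proof -
  have "(\<lambda>z. z n) \<in> borel_torus \<rightarrow>\<^sub>M circle_measure"
    unfolding borel_torus_def by measurable
  moreover have "(\<lambda>z. z) \<in> circle_measure \<rightarrow>\<^sub>M borel"
    by (subst measurable_cong_sets[OF sets_circle_measure refl]) (rule measurable_restrict_space1, simp)
  ultimately show ?thesis using measurable_compose by blast
qed

lemma measurable_into_borel_torus:
  assumes "\<And>n. (\<lambda>x. f x n) \<in> borel_measurable N"
    and "\<And>x n. x \<in> space N \<Longrightarrow> f x n \<in> sphere 0 1"
  shows "f \<in> N \<rightarrow>\<^sub>M borel_torus"
proof -
  have "(\<lambda>x. f x n) \<in> N \<rightarrow>\<^sub>M circle_measure" for n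
    by (subst measurable_cong_sets[OF refl sets_circle_measure])
       (intro measurable_restrict_space2, use assms in auto)
  then have "(\<lambda>x n. f x n) \<in> N \<rightarrow>\<^sub>M (\<Pi>\<^sub>M n\<in>UNIV. circle_measure)"
    using assms(2) by (intro measurable_PiM_single') (auto simp: space_circle_measure PiE_UNIV_domain)
  then show ?thesis by (simp add: borel_torus_def)
qed

lemma torus_mult_measurable:
  assumes "w \<in> space borel_torus"
  shows "(\<lambda>z. torus_mult z w) \<in> borel_torus \<rightarrow>\<^sub>M borel_torus"
proof (rule measurable_into_borel_torus)
  show "(\<lambda>z. torus_mult z w n) \<in> borel_measurable borel_torus" for n
    unfolding torus_mult_def by (intro borel_measurable_times coordinate_borel_measurable) simp
qed (use assms in \<open>auto simp: space_borel_torus torus_mult_def norm_mult\<close>)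

text \<open>A product measure is determined by its values on finite-dimensional boxes, and translation turns a
box into a box whose sides are rotated.\<close>

lemma distr_torus_mult:
  assumes w: "w \<in> space borel_torus"
  shows "distr borel_torus borel_torus (\<lambda>z. torus_mult z w) = borel_torus"
  unfolding borel_torus_def
proof (rule circle_product.PiM_eq)
  fix J and A :: "nat \<Rightarrow> complex set"
  assume J: "finite J" "J \<subseteq> UNIV" and A: "\<And>j. j \<in> J \<Longrightarrow> A j \<in> sets circle_measure"
  let ?M = "\<lambda>_::nat. circle_measure"
  let ?A' = "\<lambda>j. {z \<in> sphere 0 1. z * w j \<in> A j}"
  have wj: "w j \<in> sphere 0 1" for j using w by (auto simp: space_borel_torus)
  have emb: "prod_emb UNIV ?M J (PiE J B) = {z \<in> space borel_torus. \<forall>j\<in>J. z j \<in> B j}" for B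
    by (auto simp: prod_emb_def borel_torus_def space_PiM PiE_iff)
  have sets: "prod_emb UNIV ?M J (PiE J A) \<in> sets borel_torus"
    unfolding borel_torus_def using J A by (intro sets_PiM_I) auto
  have "emeasure (distr borel_torus borel_torus (\<lambda>z. torus_mult z w)) (prod_emb UNIV ?M J (PiE J A))
      = emeasure borel_torus ((\<lambda>z. torus_mult z w) -` prod_emb UNIV ?M J (PiE J A) \<inter> space borel_torus)"
    by (rule emeasure_distr[OF torus_mult_measurable[OF w] sets])
  also have "(\<lambda>z. torus_mult z w) -` prod_emb UNIV ?M J (PiE J A) \<inter> space borel_torus
      = prod_emb UNIV ?M J (PiE J ?A')"
    unfolding emb using measurable_space[OF torus_mult_measurable[OF w]]
    by (auto simp: torus_mult_def space_borel_torus)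
  also have "emeasure borel_torus \<dots> = (\<Prod>j\<in>J. emeasure circle_measure (?A' j))"
    unfolding borel_torus_def
    using J A wj by (intro circle_product.emeasure_PiM_emb sets_circle_measure_rotate)
  also have "\<dots> = (\<Prod>j\<in>J. emeasure circle_measure (A j))"
    using A wj by (intro prod.cong refl emeasure_circle_measure_rotate)
  finally show "emeasure (distr (\<Pi>\<^sub>M n\<in>UNIV. circle_measure) (\<Pi>\<^sub>M n\<in>UNIV. circle_measure) (\<lambda>z. torus_mult z w))
      (prod_emb UNIV ?M J (PiE J A)) = (\<Prod>j\<in>J. emeasure circle_measure (A j))"
    by (simp add: borel_torus_def)
qed simp

text \<open>Each coordinate is a one-parameter group of rotations with angular speed \<open>- ln p\<close>.\<close>

lemma kronecker_flow_eq_cis: "kronecker_flow t n = cis (- (t * ln (real (enumerate {p. prime p} n))))"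
proof -
  have "prime (enumerate {p::nat. prime p} n)"
    using enumerate_in_set[OF primes_infinite, of n] by simp
  then have "enumerate {p::nat. prime p} n > 0" by (rule prime_gt_0_nat)
  then show ?thesis by (simp add: kronecker_flow_def powr_def cis_conv_exp mult.assoc)
qed

lemma kronecker_flow_in_torus: "kronecker_flow t \<in> space borel_torus"
  by (simp add: space_borel_torus kronecker_flow_eq_cis)

section \<open>Functions measurable for a completed measure\<close>

lemma completion_ex_borel_measurable_complex:
  fixes g :: "'a \<Rightarrow> complex"
  assumes "g \<in> borel_measurable (completion M)"
  shows "\<exists>g'\<in>borel_measurable M. AE x in M. g x = g' x"
proof -
  have "(\<lambda>x. Re (g x)) \<in> borel_measurable (completion M)" "(\<lambda>x. Im (g x)) \<in> borel_measurable (completion M)"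
    using assms by measurable
  then obtain a b where [measurable]: "a \<in> borel_measurable M" "b \<in> borel_measurable M"
    and "AE x in M. Re (g x) = a x" "AE x in M. Im (g x) = b x"
    using completion_ex_borel_measurable_real by metis
  then have "AE x in M. g x = complex_of_real (a x) + \<i> * complex_of_real (b x)"
    by (auto simp: complex_eq_iff)
  then show ?thesis by (intro bexI[of _ "\<lambda>x. complex_of_real (a x) + \<i> * complex_of_real (b x)"]) auto
qed

lemma borel_measurable_completion_cong_AE:
  assumes g: "g \<in> borel_measurable M" and eq: "AE x in M. f x = g x"
  shows "f \<in> borel_measurable (completion M)"
proof (rule measurableI)
  fix A :: "'b set" assume A: "A \<in> sets borel"
  show "f -` A \<inter> space (completion M) \<in> sets (completion M)"
  proof (rule completion.in_sets_AE)
    show "AE x in completion M. x \<in> g -` A \<inter> space M \<longleftrightarrow> x \<in> f -` A \<inter> space (completion M)"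
      using eq by (intro AE_completion) auto
    show "g -` A \<inter> space M \<in> sets (completion M)"
      using measurable_sets[OF g A] by auto
  qed simp
qed simp

text \<open>Used both for the Haar measure on the torus and for Lebesgue measure on the line, which are
completions of their Borel restrictions.\<close>

lemma completion_integral_cong_AE:
  fixes f g :: "'a \<Rightarrow> 'b::{banach, second_countable_topology}"
  assumes g: "integrable M g" and eq: "AE x in M. f x = g x"
  shows "integrable (completion M) f" "integral\<^sup>L (completion M) f = integral\<^sup>L M g"
proof -
  have gm: "g \<in> borel_measurable M" using g by auto
  have fm: "f \<in> borel_measurable (completion M)"
    by (rule borel_measurable_completion_cong_AE[OF gm eq])
  have eq': "AE x in completion M. f x = g x" using eq by (rule AE_completion)
  show "integrable (completion M) f"
    using integrable_cong_AE[OF fm measurable_completion[OF gm] eq'] integrable_completion[OF gm] g by simp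
  show "integral\<^sup>L (completion M) f = integral\<^sup>L M g"
    using integral_cong_AE[OF fm measurable_completion[OF gm] eq'] integral_completion[OF gm] by simp
qed

section \<open>The Kronecker flow\<close>

lemma kronecker_measure_preserving_flow:
  "measure_preserving_flow borel_torus (\<lambda>t z. torus_mult z (kronecker_flow t))"
proof (intro measure_preserving_flow.intro measure_preserving_flow_axioms.intro prob_space_borel_torus)
  show "(\<lambda>(t, z). torus_mult z (kronecker_flow t)) \<in> borel \<Otimes>\<^sub>M borel_torus \<rightarrow>\<^sub>M borel_torus"
  proof (rule measurable_into_borel_torus)
    note coordinate_borel_measurable [measurable]
    show "(\<lambda>x. (case x of (t, z) \<Rightarrow> torus_mult z (kronecker_flow t)) n)
        \<in> borel_measurable (borel \<Otimes>\<^sub>M borel_torus)" for n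
      unfolding torus_mult_def kronecker_flow_eq_cis case_prod_beta by measurable
    show "(case x of (t, z) \<Rightarrow> torus_mult z (kronecker_flow t)) n \<in> sphere 0 1"
      if "x \<in> space (borel \<Otimes>\<^sub>M borel_torus)" for x n
      using that kronecker_flow_in_torus
      by (auto simp: space_pair_measure space_borel_torus torus_mult_def norm_mult)
  qed
  show "torus_mult z (kronecker_flow 0) = z" for z
    by (simp add: torus_mult_def kronecker_flow_eq_cis)
  show "torus_mult z (kronecker_flow (s + t)) = torus_mult (torus_mult z (kronecker_flow t)) (kronecker_flow s)"
    for z s t
    by (simp add: torus_mult_def kronecker_flow_eq_cis mult.assoc cis_mult algebra_simps)
  show "distr borel_torus borel_torus (\<lambda>z. torus_mult z (kronecker_flow t)) = borel_torus" for t
    by (rule distr_torus_mult[OF kronecker_flow_in_torus])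
qed

interpretation kronecker: measure_preserving_flow borel_torus "\<lambda>t z. torus_mult z (kronecker_flow t)"
  by (rule kronecker_measure_preserving_flow)

text \<open>Transfers means along one orbit from a Borel representative \<open>f'\<close> to the Haar measurable function \<open>f\<close>.
The integrals of \<open>f\<close> are taken with respect to the complete measure \<^term>\<open>lebesgue\<close>, so agreement at
almost every time already makes \<open>f\<close> measurable along the orbit.\<close>

lemma flow_average_cong_AE:
  fixes f f' :: "(nat \<Rightarrow> complex) \<Rightarrow> complex"
  assumes int: "kronecker.orbit_integrable f' z"
    and eq: "AE t in lborel. f (torus_mult z (kronecker_flow t)) = f' (torus_mult z (kronecker_flow t))"
  shows "flow_integrable f z" "flow_average f z = kronecker.orbit_mean f' z"
proof -
  let ?f = "\<lambda>T t. indicator {-T..T} t *\<^sub>R f (torus_mult z (kronecker_flow t))"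
  let ?f' = "\<lambda>T t. indicator {-T..T} t *\<^sub>R f' (torus_mult z (kronecker_flow t))"
  have int': "integrable lborel (?f' T)" for T
    using kronecker.orbit_integrableD[OF int] by (simp add: set_integrable_def)
  have eq': "AE t in lborel. ?f T t = ?f' T t" for T
    using eq by eventually_elim simp
  show "flow_integrable f z"
    using completion_integral_cong_AE(1)[OF int' eq'] by (simp add: flow_integrable_def set_integrable_def)
  show "flow_average f z = kronecker.orbit_mean f' z"
    using completion_integral_cong_AE(2)[OF int' eq']
    by (simp add: fun_eq_iff flow_average_def kronecker.orbit_mean_def set_lebesgue_integral_def)
qed

theorem theorem3p4:
  fixes F :: "nat \<Rightarrow> (nat \<Rightarrow> complex) \<Rightarrow> complex"
    and Flim G :: "(nat \<Rightarrow> complex) \<Rightarrow> complex"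
  assumes "\<And>n. F n \<in> borel_measurable torus_haar"
    and "AE z in torus_haar. (\<lambda>n. F n z) \<longlonglongrightarrow> Flim z"
    and "integrable torus_haar G"
    and "\<And>n. AE z in torus_haar. norm (F n z) \<le> norm (G z)"
  shows "integrable torus_haar Flim \<and>
    (\<forall>n. integrable torus_haar (F n)) \<and>
    (AE z in torus_haar.
       flow_integrable Flim z \<and> (\<forall>n. flow_integrable (F n) z) \<and>
       (\<exists>L l. (\<forall>n. (flow_average (F n) z \<longlongrightarrow> L n) at_top) \<and>
              L \<longlonglongrightarrow> l \<and>
              (flow_average Flim z \<longlongrightarrow> l) at_top))"
proof -
  let ?M = borel_torus
  \<comment> \<open>Borel representatives are set to zero on one Borel null set off which all hypotheses
    hold, so that domination and convergence become true at every point.\<close>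
  have "\<forall>n. \<exists>f. f \<in> borel_measurable ?M \<and> (AE z in ?M. F n z = f z)"
    using completion_ex_borel_measurable_complex assms(1) unfolding torus_haar_eq by blast
  then obtain f where f [measurable]: "\<And>n. f n \<in> borel_measurable ?M"
    and f_eq: "\<And>n. AE z in ?M. F n z = f n z" by metis
  have normG: "integrable (completion ?M) (\<lambda>z. norm (G z))"
    using assms(3) by (auto simp: torus_haar_eq)
  obtain g where g [measurable]: "g \<in> borel_measurable ?M" and g_eq: "AE z in ?M. norm (G z) = g z"
    using completion_ex_borel_measurable_real[OF borel_measurable_integrable[OF normG]] by blast
  have g_int: "integrable ?M g"
    using normG integrable_cong_AE[OF borel_measurable_integrable[OF normG]
        measurable_completion[OF g] AE_completion[OF g_eq]]
    unfolding integrable_completion[OF g] by blast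
  have "AE z in ?M. (\<forall>n. F n z = f n z) \<and> norm (G z) = g z \<and> (\<lambda>n. F n z) \<longlonglongrightarrow> Flim z
      \<and> (\<forall>n. norm (F n z) \<le> norm (G z))"
    using f_eq g_eq assms(2,4)[unfolded torus_haar_eq AE_completion_iff]
    by (simp add: AE_all_countable)
  then obtain N where N: "{z\<in>space ?M. \<not> ((\<forall>n. F n z = f n z) \<and> norm (G z) = g z
      \<and> (\<lambda>n. F n z) \<longlonglongrightarrow> Flim z \<and> (\<forall>n. norm (F n z) \<le> norm (G z)))} \<subseteq> N"
    and N_null: "emeasure ?M N = 0" and N_sets [measurable]: "N \<in> sets ?M"
    by (rule AE_E)
  have good: "F n z = f n z" "norm (G z) = g z" "(\<lambda>n. F n z) \<longlonglongrightarrow> Flim z" "norm (F n z) \<le> norm (G z)"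
    if "z \<in> space ?M" "z \<notin> N" for z n
    using N that by blast+
  define f' where "f' = (\<lambda>n z. if z \<in> N then 0 else f n z)"
  define g' where "g' = (\<lambda>z. if z \<in> N then 0 else g z)"
  \<comment> \<open>Only the Borel version of the limit is known to be measurable at this point; measurability
    of \<open>Flim\<close> is a consequence.\<close>
  define h where "h = (\<lambda>z. lim (\<lambda>n. f' n z))"
  have AE_N: "AE z in ?M. z \<notin> N"
    using N_null N_sets by (intro AE_not_in) auto
  have f'_meas [measurable]: "f' n \<in> borel_measurable ?M" for n
    unfolding f'_def by measurable
  have h_meas: "h \<in> borel_measurable ?M" unfolding h_def by measurable
  have g'_int: "integrable ?M g'"
    unfolding g'_def
    by (rule integrable_cong_AE_imp[OF g_int]) (measurable, use AE_N in eventually_elim, simp)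
  have bound: "norm (f' n z) \<le> g' z" if "z \<in> space ?M" for n z
    using good(1)[OF that] good(2)[OF that] good(4)[OF that] by (simp add: f'_def g'_def)
  have conv: "(\<lambda>n. f' n z) \<longlonglongrightarrow> (if z \<in> N then 0 else Flim z)" if "z \<in> space ?M" for z
    using good(1,3)[OF that] by (simp add: f'_def)
  have h_eq: "h z = (if z \<in> N then 0 else Flim z)" if "z \<in> space ?M" for z
    using conv[OF that] unfolding h_def by (rule limI)
  have conv': "(\<lambda>n. f' n z) \<longlonglongrightarrow> h z" if "z \<in> space ?M" for z
    using conv[OF that] h_eq[OF that] by simp
  have h_int: "integrable ?M h"
    by (rule kronecker.dominated_convergence_orbit_mean(1)[OF f'_meas h_meas g'_int])
       (fact bound conv')+
  have f'_int: "integrable ?M (f' n)" for n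
    by (rule kronecker.dominated_convergence_orbit_mean(2)[OF f'_meas h_meas g'_int])
       (fact bound conv')+
  have means: "AE z in ?M. kronecker.orbit_integrable h z \<and> (\<forall>n. kronecker.orbit_integrable (f' n) z) \<and>
      (\<exists>L l. (\<forall>n. (kronecker.orbit_mean (f' n) z \<longlongrightarrow> L n) at_top) \<and> L \<longlonglongrightarrow> l \<and>
        (kronecker.orbit_mean h z \<longlongrightarrow> l) at_top)"
    by (rule kronecker.dominated_convergence_orbit_mean(3)[OF f'_meas h_meas g'_int])
       (fact bound conv')+
  have eqs: "F n z = f' n z" "Flim z = h z" if "z \<in> space ?M" "z \<notin> N" for n z
    using good(1)[OF that] that by (simp_all add: f'_def h_eq)
  have "AE z in ?M. Flim z = h z" "AE z in ?M. F n z = f' n z" for n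
    using AE_N AE_space by (eventually_elim, simp add: eqs)+
  then have "integrable torus_haar Flim" "\<And>n. integrable torus_haar (F n)"
    unfolding torus_haar_eq using h_int f'_int completion_integral_cong_AE(1) by blast+
  moreover have "AE z in torus_haar.
       flow_integrable Flim z \<and> (\<forall>n. flow_integrable (F n) z) \<and>
       (\<exists>L l. (\<forall>n. (flow_average (F n) z \<longlongrightarrow> L n) at_top) \<and>
              L \<longlonglongrightarrow> l \<and>
              (flow_average Flim z \<longlongrightarrow> l) at_top)"
    unfolding torus_haar_eq AE_completion_iff
    using means kronecker.AE_orbit[OF AE_N] AE_space
  proof eventually_elim
    case (elim z)
    have orbit: "torus_mult z (kronecker_flow t) \<in> space ?M" for t
      by (rule kronecker.flow_space[OF elim(3)])
    have Fn: "AE t in lborel. F n (torus_mult z (kronecker_flow t)) = f' n (torus_mult z (kronecker_flow t))" for n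
      using elim(2) by eventually_elim (simp add: eqs orbit)
    have Fl: "AE t in lborel. Flim (torus_mult z (kronecker_flow t)) = h (torus_mult z (kronecker_flow t))"
      using elim(2) by eventually_elim (simp add: eqs orbit)
    have "flow_integrable (F n) z" "flow_average (F n) z = kronecker.orbit_mean (f' n) z" for n
      using elim(1) flow_average_cong_AE[OF _ Fn] by auto
    moreover have "flow_integrable Flim z" "flow_average Flim z = kronecker.orbit_mean h z"
      using elim(1) flow_average_cong_AE[OF _ Fl] by auto
    ultimately show ?case using elim(1) by simp
  qed
  ultimately show ?thesis by blast
qed

end
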